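(* Let $\alpha$ be an integer with $\alpha\notin\{0,1,2\}$. Then the Macdonald group $G(\alpha)=\langle A,B\mid A^{[A,B]}=A^\alpha,\ B^{[B,A]}=B^\alpha\rangle$ is nilpotent of class at most $7$.
   Context: For elements $a,b$ of a group, $[a,b]=a^{-1}b^{-1}ab$ and $b^a=a^{-1}ba$. *)

theory Defs
  imports "HOL-Algebra.Algebra"
begin

section \<open>Free groups\<close>

text \<open>The letter \<open>(x, True)\<close> is the generator \<open>x\<close> and \<open>(x, False)\<close> its formal inverse.
  The free group consists of the reduced words, multiplied by concatenation followed by
  cancellation.\<close>

definition inv_letter :: "'a \<times> bool \<Rightarrow> 'a \<times> bool" where
  "inv_letter l = (fst l, \<not> snd l)"

definition reduced :: "('a \<times> bool) list \<Rightarrow> bool" where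
  "reduced w \<longleftrightarrow> successively (\<lambda>k l. l \<noteq> inv_letter k) w"

definition push_letter :: "'a \<times> bool \<Rightarrow> ('a \<times> bool) list \<Rightarrow> ('a \<times> bool) list" where
  "push_letter l w = (if w \<noteq> [] \<and> hd w = inv_letter l then tl w else l # w)"

definition free_group :: "'a set \<Rightarrow> ('a \<times> bool) list monoid" where
  "free_group S =
     \<lparr>carrier = {w. reduced w \<and> fst ` set w \<subseteq> S},
      monoid.mult = (\<lambda>u v. foldr push_letter u v),
      one = []\<rparr>"

definition free_gen :: "'a \<Rightarrow> ('a \<times> bool) list" where
  "free_gen x = [(x, True)]"

lemma inv_letter_inv_letter [simp]: "inv_letter (inv_letter l) = l"
  by (simp add: inv_letter_def)

lemma inv_letter_neq [simp]: "inv_letter l \<noteq> l" "l \<noteq> inv_letter l"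
  by (auto simp: inv_letter_def prod_eq_iff)

lemma reduced_Nil [simp]: "reduced []"
  by (simp add: reduced_def)

lemma reduced_Cons: "reduced (l # w) \<longleftrightarrow> (w = [] \<or> hd w \<noteq> inv_letter l) \<and> reduced w"
  by (cases w) (auto simp: reduced_def)

lemma reduced_push_letter: "reduced w \<Longrightarrow> reduced (push_letter l w)"
  by (cases w) (auto simp: push_letter_def reduced_Cons)

lemma push_letter_inv_letter:
  "reduced w \<Longrightarrow> push_letter l (push_letter (inv_letter l) w) = w"
  by (cases w) (auto simp: push_letter_def reduced_Cons)

lemma push_letter_inv_letter':
  "reduced w \<Longrightarrow> push_letter (inv_letter l) (push_letter l w) = w"
  using push_letter_inv_letter[of w "inv_letter l"] by simp

lemma reduced_foldr_push: "reduced v \<Longrightarrow> reduced (foldr push_letter u v)"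
  by (induction u) (auto intro: reduced_push_letter)

lemma set_push_letter: "set (push_letter l w) \<subseteq> insert l (set w)"
  by (auto simp: push_letter_def dest: list.set_sel(2))

lemma set_foldr_push: "set (foldr push_letter u v) \<subseteq> set u \<union> set v"
proof (induction u)
  case (Cons l u)
  then show ?case
    using set_push_letter[of l "foldr push_letter u v"] by auto
qed simp

lemma foldr_push_push:
  assumes "reduced w"
  shows "foldr push_letter (push_letter l u) w = push_letter l (foldr push_letter u w)"
proof (cases "u \<noteq> [] \<and> hd u = inv_letter l")
  case True
  then obtain u' where u: "u = inv_letter l # u'"
    by (metis list.collapse)
  show ?thesis
    using push_letter_inv_letter[OF reduced_foldr_push[OF assms]]
    by (simp add: u push_letter_def[of l "inv_letter l # u'"])
qed (auto simp: push_letter_def)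

lemma foldr_push_assoc:
  assumes "reduced w"
  shows "foldr push_letter (foldr push_letter u v) w =
         foldr push_letter u (foldr push_letter v w)"
  by (induction u) (simp_all add: foldr_push_push assms)

lemma foldr_push_Nil: "reduced w \<Longrightarrow> foldr push_letter w [] = w"
  by (induction w) (auto simp: reduced_Cons push_letter_def)

lemma foldr_push_inverse:
  assumes "reduced v"
  shows "foldr push_letter (rev (map inv_letter w)) (foldr push_letter w v) = v"
  using assms
  by (induction w arbitrary: v) (auto simp: push_letter_inv_letter' reduced_foldr_push)

lemma group_free_group: "group (free_group S)"
proof (rule groupI)
  fix u v assume "u \<in> carrier (free_group S)" "v \<in> carrier (free_group S)"
  then show "u \<otimes>\<^bsub>free_group S\<^esub> v \<in> carrier (free_group S)"
    using image_mono[OF set_foldr_push[of u v], of fst]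
    by (simp add: free_group_def reduced_foldr_push image_Un) blast
next
  fix w assume w: "w \<in> carrier (free_group S)"
  define w' where "w' = foldr push_letter (rev (map inv_letter w)) []"
  have "foldr push_letter w' w = []"
    using w foldr_push_assoc[of w] foldr_push_inverse[of "[]" w]
    by (simp add: w'_def free_group_def foldr_push_Nil)
  moreover have "w' \<in> carrier (free_group S)"
  proof -
    have "set w' \<subseteq> inv_letter ` set w"
      using set_foldr_push[of "rev (map inv_letter w)" "[]"] by (simp add: w'_def)
    then have "fst ` set w' \<subseteq> fst ` set w"
      by (force simp: inv_letter_def)
    then show ?thesis
      using w by (auto simp: w'_def free_group_def reduced_foldr_push)
  qed
  ultimately show "\<exists>w'\<in>carrier (free_group S). w' \<otimes>\<^bsub>free_group S\<^esub> w = \<one>\<^bsub>free_group S\<^esub>"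
    by (auto simp: free_group_def)
qed (auto simp: free_group_def foldr_push_assoc)

lemma free_gen_in_carrier: "x \<in> S \<Longrightarrow> free_gen x \<in> carrier (free_group S)"
  by (simp add: free_gen_def free_group_def reduced_Cons)


section \<open>Presentations\<close>

definition normal_closure :: "('a, 'b) monoid_scheme \<Rightarrow> 'a set \<Rightarrow> 'a set" where
  "normal_closure G R = \<Inter>{N. N \<lhd> G \<and> R \<subseteq> N}"

text \<open>A pair \<open>(u, v)\<close> in \<open>R\<close> stands for the relation \<open>u = v\<close>.\<close>

definition presented_group ::
  "'a set \<Rightarrow> (('a \<times> bool) list \<times> ('a \<times> bool) list) set \<Rightarrow> ('a \<times> bool) list set monoid" where
  "presented_group S R =
     free_group S Mod
       normal_closure (free_group S) {u \<otimes>\<^bsub>free_group S\<^esub> inv\<^bsub>free_group S\<^esub> v | u v. (u, v) \<in> R}"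

lemma (in group) normal_closure_normal:
  assumes "R \<subseteq> carrier G"
  shows "normal_closure G R \<lhd> G"
proof -
  have carr: "carrier G \<in> {N. N \<lhd> G \<and> R \<subseteq> N}"
    using assms by (auto simp: normal_inv_iff subgroup_self)
  have "subgroup (\<Inter>{N. N \<lhd> G \<and> R \<subseteq> N}) G"
    using carr by (intro subgroups_Inter) (auto simp: normal_inv_iff)
  then show ?thesis
    by (auto simp: normal_inv_iff normal_closure_def)
qed

lemma group_presented_group:
  assumes "\<And>u v. (u, v) \<in> R \<Longrightarrow> u \<in> carrier (free_group S) \<and> v \<in> carrier (free_group S)"
  shows "group (presented_group S R)"
proof -
  interpret F: group "free_group S" by (rule group_free_group)
  show ?thesis
    unfolding presented_group_def using assms
    by (intro normal.factorgroup_is_group F.normal_closure_normal) blast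
qed


section \<open>Commutators and nilpotency\<close>

definition commutator :: "('a, 'b) monoid_scheme \<Rightarrow> 'a \<Rightarrow> 'a \<Rightarrow> 'a" where
  "commutator G a b = inv\<^bsub>G\<^esub> a \<otimes>\<^bsub>G\<^esub> inv\<^bsub>G\<^esub> b \<otimes>\<^bsub>G\<^esub> a \<otimes>\<^bsub>G\<^esub> b"

definition conjugate :: "('a, 'b) monoid_scheme \<Rightarrow> 'a \<Rightarrow> 'a \<Rightarrow> 'a" where
  "conjugate G b a = inv\<^bsub>G\<^esub> a \<otimes>\<^bsub>G\<^esub> b \<otimes>\<^bsub>G\<^esub> a"

text \<open>The index is shifted: \<open>lower_central G n\<close> is the term usually written
  \<open>\<gamma>\<^sub>n\<^sub>+\<^sub>1(G)\<close>, so that class at most \<open>c\<close> means that \<open>lower_central G c\<close> is trivial.\<close>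

fun lower_central :: "('a, 'b) monoid_scheme \<Rightarrow> nat \<Rightarrow> 'a set" where
  "lower_central G 0 = carrier G"
| "lower_central G (Suc n) =
     generate G {commutator G x y | x y. x \<in> lower_central G n \<and> y \<in> carrier G}"

definition nilpotent_group :: "('a, 'b) monoid_scheme \<Rightarrow> bool" where
  "nilpotent_group G \<longleftrightarrow> group G \<and> (\<exists>c. lower_central G c = {\<one>\<^bsub>G\<^esub>})"

text \<open>Only meaningful for nilpotent groups.\<close>

definition nilpotency_class :: "('a, 'b) monoid_scheme \<Rightarrow> nat" where
  "nilpotency_class G = (LEAST c. lower_central G c = {\<one>\<^bsub>G\<^esub>})"


section \<open>Macdonald groups\<close>

datatype macdonald_gen = Gen_A | Gen_B

definition macdonald_relations ::
  "int \<Rightarrow> ((macdonald_gen \<times> bool) list \<times> (macdonald_gen \<times> bool) list) set" where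
  "macdonald_relations \<alpha> =
     (let F = free_group UNIV; A = free_gen Gen_A; B = free_gen Gen_B
      in {(conjugate F A (commutator F A B), A [^]\<^bsub>F\<^esub> \<alpha>),
          (conjugate F B (commutator F B A), B [^]\<^bsub>F\<^esub> \<alpha>)})"

definition macdonald_group :: "int \<Rightarrow> (macdonald_gen \<times> bool) list set monoid" where
  "macdonald_group \<alpha> = presented_group UNIV (macdonald_relations \<alpha>)"

lemma group_macdonald_group: "group (macdonald_group \<alpha>)"
proof -
  interpret F: group "free_group (UNIV :: macdonald_gen set)" by (rule group_free_group)
  show ?thesis
    unfolding macdonald_group_def
    by (rule group_presented_group)
       (auto simp: macdonald_relations_def Let_def conjugate_def commutator_def free_gen_in_carrier)
qed

end

theory Submission
  imports Defs "HOL-Number_Theory.Number_Theory"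
begin

text \<open>
  Write \<open>C = [A, B]\<close>, \<open>x = \<alpha> - 1\<close> and \<open>s\<^sub>n = \<alpha> + \<dots> + \<alpha>\<^sup>n\<close>.  Computing \<open>[A, B\<^sup>n]\<close> in two ways for
  \<open>n = \<alpha>\<^sup>j\<close> shows that \<open>A\<^sup>K\<close> is central for \<open>K = \<alpha>\<^sup>n\<^sup>+\<^sup>j - s\<^sub>n\<close>, and hence that \<open>A\<^sup>K\<^sup>x = 1\<close>.  So \<open>A\<close>
  and \<open>B\<close> have finite order, and \<open>\<alpha>\<close> may be replaced by a congruent exponent that is at least 3.
  Varying \<open>j\<close>, every prime divisor of the order of \<open>A\<close> divides \<open>x\<close>; together with a 3-adic
  analysis of the exponents \<open>K\<close> for \<open>j = 1, 2\<close> this shows that \<open>A\<^sup>d\<close> and \<open>B\<^sup>d\<close> are central, where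
  \<open>w = x\<^sup>2\<close> or \<open>w = x\<^sup>2 / 2\<close> according to the parity of \<open>x\<close>, and \<open>d = 3 w\<close> or \<open>d = w\<close> according to
  whether 3 divides \<open>x\<close>.  Since \<open>[C\<^sup>k, A]\<close> is a power of \<open>A\<close>, and \<open>[A\<^sup>k, B]\<close> is \<open>C\<^sup>k\<close> times a power
  of \<open>A\<close>, the elements \<open>A\<^sup>d\<close>, \<open>C\<^sup>w\<close>, \<open>A\<^sup>w\<close>, \<open>C\<^sup>x\<close>, \<open>A\<^sup>x\<close>, \<open>C\<close>, \<open>A\<close> (and likewise for \<open>B\<close>) lie in the
  successive terms of the upper central series.
\<close>

section \<open>Arithmetic of the exponents\<close>

text \<open>The binomial theorem up to degree three, multiplied by 6 to clear denominators. The
  truncated polynomial fails the recursion of the power by exactly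
  \<open>x ^ 4 * (m * (m - 1) * (m - 2))\<close>.\<close>

lemma power_one_plus_mod_pow4:
  fixes x :: int
  shows "x ^ 4 dvd 6 * (1 + x) ^ m - (6 + 6 * int m * x + 3 * int m * (int m - 1) * x\<^sup>2
    + int m * (int m - 1) * (int m - 2) * x ^ 3)"
proof (induction m)
  case (Suc m)
  let ?r = "\<lambda>k::int. 6 + 6 * k * x + 3 * k * (k - 1) * x\<^sup>2 + k * (k - 1) * (k - 2) * x ^ 3"
  have "6 * (1 + x) ^ Suc m - ?r (int (Suc m)) =
      (1 + x) * (6 * (1 + x) ^ m - ?r (int m)) + x ^ 4 * (int m * (int m - 1) * (int m - 2))"
    by (simp add: algebra_simps power2_eq_square power3_eq_cube power4_eq_xxxx)
  with Suc show ?case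
    by simp
qed simp

lemma prod_consecutive4_dvd: "3 dvd m * (m - 1) * (m - 2) * (m - 3 :: int)"
proof -
  have "m mod 3 = 0 \<or> m mod 3 = 1 \<or> m mod 3 = 2" by presburger
  then have "3 dvd m \<or> 3 dvd m - 1 \<or> 3 dvd m - 2" by presburger
  then show ?thesis by auto
qed

text \<open>Eight times the binomial expansion of \<open>(1 + 3 * u) ^ m\<close> up to degree four.
  Of the denominator 24 only the factor 8 has to be cleared, because powers of 3 absorb the rest; 8
  is invertible modulo 243.\<close>

definition binomial_truncation :: "int \<Rightarrow> int \<Rightarrow> int" where
  "binomial_truncation u m = 8 + 24 * m * u + 36 * (m * (m - 1)) * u\<^sup>2
     + 36 * (m * (m - 1) * (m - 2)) * u ^ 3 + 27 * (m * (m - 1) * (m - 2) * (m - 3)) * u ^ 4"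

text \<open>Terms of degree five and more carry the factor \<open>3 ^ 5 = 243\<close>. In the
  induction step 81 is visible in the error, and the missing 3 comes from the four consecutive
  factors.\<close>

lemma power_one_plus_3_mod_243:
  fixes u :: int
  shows "[8 * (1 + 3 * u) ^ m = binomial_truncation u (int m)] (mod 243)"
proof (induction m)
  case (Suc m)
  define k where "k = int m"
  obtain l where l: "k * (k - 1) * (k - 2) * (k - 3) = 3 * l"
    using prod_consecutive4_dvd[of k] by blast
  have "(1 + 3 * u) * binomial_truncation u k - binomial_truncation u (k + 1) =
      81 * (k * (k - 1) * (k - 2) * (k - 3)) * u ^ 5"
    by (simp add: binomial_truncation_def algebra_simps eval_nat_numeral)
  also have "\<dots> = 243 * (l * u ^ 5)"
    by (simp add: l)
  finally have 1: "[(1 + 3 * u) * binomial_truncation u k = binomial_truncation u (k + 1)] (mod 243)"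
    by (simp add: cong_iff_dvd_diff)
  have "[8 * (1 + 3 * u) ^ Suc m = (1 + 3 * u) * binomial_truncation u k] (mod 243)"
    using cong_scalar_left[OF Suc, of "1 + 3 * u"] by (simp add: k_def algebra_simps)
  from cong_trans[OF this 1] show ?case
    by (simp add: k_def add.commute)
qed (simp add: binomial_truncation_def)

text \<open>The exponent for \<open>j = 1\<close> alone can be divisible by 81 although 9 does not divide \<open>\<alpha> - 1\<close>, for
  instance when \<open>\<alpha> = 25\<close>; the exponent for \<open>j = 2\<close> excludes this.\<close>

lemma not_243_dvd_power_expressions:
  fixes u \<alpha> :: int and n :: nat
  assumes u: "\<not> 3 dvd u" and \<alpha>: "\<alpha> = 1 + 3 * u" and n: "int n = \<alpha>"
    and dvd1: "243 dvd (\<alpha> - 1) * \<alpha> ^ (n + 1) - (\<alpha> ^ (n + 1) - \<alpha>)"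
  shows "\<not> 243 dvd (\<alpha> - 1) * \<alpha> ^ (n\<^sup>2 + 2) - (\<alpha> ^ (n\<^sup>2 + 1) - \<alpha>)"
proof
  assume dvd2: "243 dvd (\<alpha> - 1) * \<alpha> ^ (n\<^sup>2 + 2) - (\<alpha> ^ (n\<^sup>2 + 1) - \<alpha>)"
  have P: "[8 * \<alpha> ^ m = binomial_truncation u (int m)] (mod 243)" for m
    using power_one_plus_3_mod_243[of u m] by (simp add: \<alpha>)
  have remainder_dvd: "243 dvd w"
    if "[8 * y = 243 * z + w] (mod 243)" "243 dvd y" for w y z :: int
  proof -
    have "243 dvd 243 * z + w"
      using that cong_dvd_iff[OF that(1)] by simp
    then show ?thesis
      using dvd_add_right_iff[of 243 "243 * z" w] by simp
  qed
  have "[(3 * u - 1) * (8 * \<alpha> ^ (n + 1)) + 8 * \<alpha> =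
      (3 * u - 1) * binomial_truncation u (int (n + 1)) + 8 * \<alpha>] (mod 243)"
    by (intro cong_add cong_mult P cong_refl)
  \<comment> \<open>With \<open>n = 1 + 3 * u\<close> everything is a polynomial in
    \<open>u\<close>, here split into a multiple of 243 and a remainder divisible by
    \<open>27 * u ^ 3\<close>.\<close>
  also have "(3 * u - 1) * binomial_truncation u (int (n + 1)) + 8 * \<alpha> =
      243 * (u ^ 4 * (1 + 3 * u + 7 * u\<^sup>2 + 3 * u ^ 3 + 9 * u ^ 4 + 27 * u ^ 5))
      + 27 * (u ^ 3 * (4 + 7 * u + 3 * u\<^sup>2))"
    by (simp add: n \<alpha> binomial_truncation_def algebra_simps eval_nat_numeral)
  also have "(3 * u - 1) * (8 * \<alpha> ^ (n + 1)) + 8 * \<alpha> =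
      8 * ((\<alpha> - 1) * \<alpha> ^ (n + 1) - (\<alpha> ^ (n + 1) - \<alpha>))"
    by (simp add: \<alpha> algebra_simps)
  finally have d1: "243 dvd 27 * (u ^ 3 * (4 + 7 * u + 3 * u\<^sup>2))"
    by (rule remainder_dvd[OF _ dvd1])
  have "[3 * u * (8 * \<alpha> ^ (n\<^sup>2 + 2)) - 8 * \<alpha> ^ (n\<^sup>2 + 1) + 8 * \<alpha> =
      3 * u * binomial_truncation u (int (n\<^sup>2 + 2)) - binomial_truncation u (int (n\<^sup>2 + 1)) + 8 * \<alpha>] (mod 243)"
    by (intro cong_add cong_diff cong_mult P cong_refl)
  also have "3 * u * binomial_truncation u (int (n\<^sup>2 + 2)) - binomial_truncation u (int (n\<^sup>2 + 1)) + 8 * \<alpha> =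
      243 * (u ^ 4 * (7 + 32 * u + 114 * u\<^sup>2 + 354 * u ^ 3 + 909 * u ^ 4 + 2025 * u ^ 5
        + 3726 * u ^ 6 + 5346 * u ^ 7 + 5103 * u ^ 8 + 2187 * u ^ 9)) + 27 * (u ^ 3 * (8 + 5 * u))"
    by (simp add: n \<alpha> binomial_truncation_def algebra_simps eval_nat_numeral)
  also have "3 * u * (8 * \<alpha> ^ (n\<^sup>2 + 2)) - 8 * \<alpha> ^ (n\<^sup>2 + 1) + 8 * \<alpha> =
      8 * ((\<alpha> - 1) * \<alpha> ^ (n\<^sup>2 + 2) - (\<alpha> ^ (n\<^sup>2 + 1) - \<alpha>))"
    by (simp add: \<alpha> algebra_simps)
  finally have d2: "243 dvd 27 * (u ^ 3 * (8 + 5 * u))"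
    by (rule remainder_dvd[OF _ dvd2])
  have "9 dvd v" if "243 dvd 27 * (u ^ 3 * v)" for v
  proof -
    have "27 * 9 dvd 27 * (u ^ 3 * v)" using that by simp
    then have "9 dvd u ^ 3 * v"
      by (simp only: dvd_mult_cancel_left) simp
    moreover have "coprime (9::int) (u ^ 3)"
      using u prime_imp_coprime[of "3::int" u] coprime_power_left_iff[of 3 2 "u ^ 3"] by simp
    ultimately show ?thesis by (simp add: coprime_dvd_mult_right_iff)
  qed
  \<comment> \<open>The second condition forces \<open>u\<close> to be 2 modulo 9, where the first
    polynomial is 3 modulo 9.\<close>
  from this[OF d1] this[OF d2] have *: "9 dvd 4 + 7 * u + 3 * u\<^sup>2" "9 dvd 8 + 5 * u" .
  from *(2) obtain k where "8 + 5 * u = 9 * k" by (rule dvdE)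
  \<comment> \<open>As 2 inverts 5 modulo 9, doubling \<open>5 * u = 9 * k - 8\<close> and
    subtracting \<open>9 * u\<close> solves for \<open>u\<close>.\<close>
  define v where "v = 2 * k - u - 2"
  have u_eq: "u = 2 + 9 * v"
    using \<open>8 + 5 * u = 9 * k\<close> by (simp add: v_def)
  have "4 + 7 * u + 3 * u\<^sup>2 = 9 * (3 + 19 * v + 27 * v\<^sup>2) + 3"
    unfolding u_eq by (simp add: algebra_simps power2_eq_square)
  with *(1) show False
    using dvd_add_right_iff[of 9 "9 * (3 + 19 * v + 27 * v\<^sup>2)" 3] by simp
qed

section \<open>Prime divisors of the order\<close>

lemma coprime_if_no_common_prime:
  fixes d y :: int
  assumes "d \<noteq> 0" "\<And>p. Factorial_Ring.prime p \<Longrightarrow> p dvd d \<Longrightarrow> p dvd y \<Longrightarrow> False"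
  shows "coprime d y"
proof (rule ccontr)
  assume "\<not> coprime d y"
  then have "\<not> is_unit (gcd d y)"
    by (simp only: is_unit_gcd not_False_eq_True)
  with assms(1) obtain p where "Factorial_Ring.prime p" "p dvd gcd d y"
    using prime_divisor_exists[of "gcd d y"] by auto
  with assms(2)[of p] show False by simp
qed

text \<open>Let \<open>k\<close> be the order of \<open>\<alpha>\<close> modulo \<open>q\<close>. It
  divides \<open>M\<close> and so is coprime to \<open>\<alpha>\<close>; hence
  \<open>n = \<alpha> ^ j\<close> is 1 modulo \<open>k\<close> for \<open>j = totient k\<close>.
  Then \<open>\<alpha> ^ n\<close> is \<open>\<alpha>\<close> modulo \<open>q\<close>, and the
  hypothesis for this \<open>j\<close> reduces modulo \<open>q\<close> to
  \<open>\<alpha> * (\<alpha> - 1) * (n - 1)\<close>. If \<open>q\<close> divides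
  \<open>n - 1\<close>, then \<open>k\<close> divides \<open>totient k\<close>, which forces
  \<open>k = 1\<close>.\<close>

lemma prime_dvd_pred:
  fixes \<alpha> M q :: nat
  assumes "M > 0" and M: "int M dvd int \<alpha> ^ M - 1"
    and K: "\<And>j. int M dvd (int \<alpha> - 1) * int \<alpha> ^ (\<alpha> ^ j + j) - (int \<alpha> ^ (\<alpha> ^ j + 1) - int \<alpha>)"
    and q: "Factorial_Ring.prime q" "q dvd M"
  shows "int q dvd int \<alpha> - 1"
proof -
  define k where "k = Pocklington.ord q \<alpha>"
  have qM: "int q dvd int \<alpha> ^ M - 1"
    using q(2) M by (meson dvd_trans int_dvd_int_iff)
  then have "[int (\<alpha> ^ M) = int 1] (mod int q)"
    by (simp add: cong_iff_dvd_diff)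
  then have "[\<alpha> ^ M = 1] (mod q)"
    by (simp only: cong_int_iff)
  then have kM: "k dvd M"
    by (simp only: k_def ord_divides)
  have "coprime (int M) (int \<alpha>)"
  proof (rule coprimeI)
    fix c assume "c dvd int M" "c dvd int \<alpha>"
    then have "c dvd int \<alpha> ^ M - 1" "c dvd int \<alpha> ^ M"
      using M \<open>M > 0\<close> by (auto intro: dvd_trans dvd_trans[OF _ dvd_power])
    then show "c dvd 1"
      using dvd_diff[of c "int \<alpha> ^ M" "int \<alpha> ^ M - 1"] by simp
  qed
  then have M\<alpha>: "coprime M \<alpha>" by simp
  then have q\<alpha>: "coprime q \<alpha>" and k\<alpha>: "coprime k \<alpha>"
    using coprime_divisors[OF q(2) dvd_refl] coprime_divisors[OF kM dvd_refl] by blast+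
  have "k > 0" using q\<alpha> by (simp add: k_def)
  define j where "j = totient k"
  define n where "n = \<alpha> ^ j"
  have "[n = 1] (mod k)"
    using k\<alpha> euler_theorem[of \<alpha> k] by (simp add: n_def j_def coprime_commute)
  then have \<alpha>n: "[\<alpha> ^ n = \<alpha>] (mod q)"
    using order_divides_expdiff[OF q\<alpha>, of n 1] by (simp add: k_def)
  have "[int (\<alpha> ^ n) = int \<alpha>] (mod int q)"
    using \<alpha>n by (simp only: cong_int_iff)
  then have \<alpha>n': "[int \<alpha> ^ n = int \<alpha>] (mod int q)"
    by simp
  have "[(int \<alpha> - 1) * (int \<alpha> ^ n * int n) - (int \<alpha> ^ n * int \<alpha> - int \<alpha>)
      = (int \<alpha> - 1) * (int \<alpha> * int n) - (int \<alpha> * int \<alpha> - int \<alpha>)] (mod int q)"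
    by (intro cong_diff cong_mult cong_refl \<alpha>n')
  moreover have "int q dvd (int \<alpha> - 1) * (int \<alpha> ^ n * int n) - (int \<alpha> ^ n * int \<alpha> - int \<alpha>)"
    using K[of j] q(2) by (simp add: n_def power_add mult_ac) (meson dvd_trans int_dvd_int_iff)
  ultimately have "int q dvd (int \<alpha> - 1) * (int \<alpha> * int n) - (int \<alpha> * int \<alpha> - int \<alpha>)"
    by (simp only: cong_dvd_iff)
  also have "\<dots> = int \<alpha> * ((int \<alpha> - 1) * (int n - 1))"
    by (simp add: algebra_simps)
  finally have "int q dvd (int \<alpha> - 1) * (int n - 1)"
    using q\<alpha> by (simp add: coprime_dvd_mult_right_iff)
  then consider "int q dvd int \<alpha> - 1" | "int q dvd int n - 1"
    using q(1) by (auto simp: prime_dvd_mult_iff)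
  then show ?thesis
  proof cases
    case 2
    then have "[int n = int 1] (mod int q)" by (simp add: cong_iff_dvd_diff)
    then have "[\<alpha> ^ j = 1] (mod q)" by (simp only: cong_int_iff n_def)
    then have "k dvd totient k" by (simp only: k_def j_def ord_divides)
    then have "k \<le> totient k" using \<open>k > 0\<close> by (simp add: dvd_imp_le)
    then have "k = 1" using \<open>k > 0\<close> totient_less[of k] by linarith
    then have "[\<alpha> = 1] (mod q)" using ord_eq_Suc_0_iff[of q \<alpha>] by (simp add: k_def)
    then have "[int \<alpha> = int 1] (mod int q)" by (simp only: cong_int_iff)
    then show ?thesis by (simp add: cong_iff_dvd_diff)
  qed
qed

section \<open>The exponents \<open>w = halved_square x\<close> and
  \<open>d = central_exponent x\<close>\<close>

definition halved_square :: "int \<Rightarrow> int" where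
  "halved_square x = (if even x then x\<^sup>2 div 2 else x\<^sup>2)"

definition central_exponent :: "int \<Rightarrow> int" where
  "central_exponent x = (if 3 dvd x then 3 * halved_square x else halved_square x)"

lemma square_eq_halved_square:
  "x\<^sup>2 = (if even x then 2 else 1) * halved_square x"
  by (auto simp: halved_square_def)

lemma nine_dvd_halved_square:
  assumes "3 dvd x"
  shows "9 dvd halved_square x"
proof -
  from assms obtain u where "x = 3 * u" by blast
  then have "9 dvd x\<^sup>2" by (simp add: power_mult_distrib)
  then show ?thesis
    unfolding square_eq_halved_square by (auto split: if_splits) presburger
qed

text \<open>The expansion gives \<open>6 * K1 = (1 + x) * x\<^sup>2 * (3 + x * t)\<close>. As all
  primes of \<open>d\<close> divide \<open>x\<close>, the factors other than
  \<open>x\<^sup>2\<close> can be stripped, except for powers of 3 when \<open>x = 3 * u\<close> and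
  3 does not divide \<open>u\<close>. In that case \<open>K1\<close> and \<open>K2\<close> together
  bound the 3-part of \<open>d\<close>.\<close>

lemma dvd_central_exponent:
  fixes d x K1 K2 :: int and n :: nat
  assumes n: "int n = 1 + x" and x: "x > 0" and d: "d > 0"
    and primes: "\<And>p. Factorial_Ring.prime p \<Longrightarrow> p dvd d \<Longrightarrow> p dvd x"
    and K: "d dvd K1" "d dvd K2"
    and K1: "x * K1 = x * (1 + x) ^ (n + 1) - ((1 + x) ^ (n + 1) - (1 + x))"
    and K2: "x * K2 = x * (1 + x) ^ (n\<^sup>2 + 2) - ((1 + x) ^ (n\<^sup>2 + 1) - (1 + x))"
  shows "d dvd central_exponent x"
proof -
  define w where "w = halved_square x"
  have x2: "x\<^sup>2 = (if even x then 2 else 1) * w"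
    unfolding w_def by (rule square_eq_halved_square)
  have copr: "coprime d y" if "\<And>p. Factorial_Ring.prime p \<Longrightarrow> p dvd d \<Longrightarrow> p dvd x \<Longrightarrow> p dvd y \<Longrightarrow> False" for y
    using that primes d by (intro coprime_if_no_common_prime) auto
  have copr_\<alpha>: "coprime d (1 + x)"
  proof (rule copr)
    fix p :: int assume p: "Factorial_Ring.prime p" "p dvd x" "p dvd 1 + x"
    then have "p dvd 1" by (simp add: dvd_add_left_iff)
    with p(1) show False using not_prime_unit by blast
  qed
  have "x ^ 4 dvd 6 * (1 + x) ^ n - (6 + 6 * int n * x + 3 * int n * (int n - 1) * x\<^sup>2
      + int n * (int n - 1) * (int n - 2) * x ^ 3)"
    by (rule power_one_plus_mod_pow4)
  then obtain q where q: "6 * (1 + x) ^ n = 6 + 6 * int n * x + 3 * int n * (int n - 1) * x\<^sup>2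
      + int n * (int n - 1) * (int n - 2) * x ^ 3 + x ^ 4 * q"
    by (metis dvdE add.commute diff_add_cancel)
  have "x * (6 * K1) = (1 + x) * ((6 * (1 + x) ^ n) * (x - 1) + 6)"
    using K1 by (simp add: algebra_simps)
  \<comment> \<open>With \<open>n = 1 + x\<close> the terms of degree at most two in
    \<open>6 * (1 + x) ^ n * (x - 1) + 6\<close> cancel, and the sum starts with
    \<open>3 * x ^ 3\<close>.\<close>
  also have "\<exists>t. \<dots> = x * ((1 + x) * x\<^sup>2 * (3 + x * t))"
  proof
    show "(1 + x) * ((6 * (1 + x) ^ n) * (x - 1) + 6) =
      x * ((1 + x) * x\<^sup>2 * (3 + x * (3 * x + (1 + x) * (x - 1) * (x - 1) + q * (x - 1))))"
      unfolding q n by (simp add: algebra_simps eval_nat_numeral)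
  qed
  finally obtain t where "x * (6 * K1) = x * ((1 + x) * x\<^sup>2 * (3 + x * t))" by blast
  with x have t: "6 * K1 = (1 + x) * x\<^sup>2 * (3 + x * t)" by simp
  show ?thesis
  proof (cases "3 dvd x")
    case False
    have "6 * K1 = (if even x then 2 else 1) * ((1 + x) * (w * (3 + x * t)))"
      using t unfolding x2 by (simp add: mult_ac)
    then have "(if even x then 3 else 6) * K1 = (1 + x) * (w * (3 + x * t))"
      by (auto split: if_splits)
    then have "d dvd (1 + x) * (w * (3 + x * t))"
      using K(1) by (metis dvd_mult)
    then have "d dvd w * (3 + x * t)"
      using copr_\<alpha> by (simp add: coprime_dvd_mult_right_iff)
    moreover have "coprime d (3 + x * t)"
    proof (rule copr)
      fix p :: int assume p: "Factorial_Ring.prime p" "p dvd x" "p dvd 3 + x * t"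
      then have "p dvd 3" by (simp add: dvd_add_left_iff)
      then have "p = 3" using p(1) by (simp add: primes_dvd_imp_eq)
      with p False show False by simp
    qed
    ultimately show ?thesis
      using False by (simp add: coprime_dvd_mult_left_iff central_exponent_def w_def)
  next
    case True
    then obtain u where u: "x = 3 * u" by blast
    have K1': "2 * K1 = (1 + x) * x\<^sup>2 * (1 + u * t)"
      using t u by simp
    then have "2 * K1 = (if even x then 2 else 1) * ((1 + x) * (w * (1 + u * t)))"
      unfolding x2 by (simp add: mult_ac)
    then have "(if even x then 1 else 2) * K1 = (1 + x) * (w * (1 + u * t))"
      by (auto split: if_splits)
    then have "d dvd (1 + x) * (w * (1 + u * t))"
      using K(1) by (metis dvd_mult)
    then have dw: "d dvd w * (1 + u * t)"
      using copr_\<alpha> by (simp add: coprime_dvd_mult_right_iff)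
    show ?thesis
    proof (cases "3 dvd u")
      case 3: True
      have "coprime d (1 + u * t)"
      proof (rule copr)
        fix p :: int assume p: "Factorial_Ring.prime p" "p dvd x" "p dvd 1 + u * t"
        then have "p dvd 3 \<or> p dvd u" by (simp add: u prime_dvd_mult_iff)
        then have "p dvd u" using 3 by (auto intro: dvd_trans)
        with p have "p dvd 1" by (simp add: dvd_add_left_iff)
        with p(1) show False using not_prime_unit by blast
      qed
      then show ?thesis
        using dw True by (simp add: coprime_dvd_mult_left_iff central_exponent_def w_def)
    next
      case 3: False
      \<comment> \<open>Here \<open>1 + u * t\<close> may contain factors 3. The factor 3 of
        \<open>x\<close> turns 81 into the modulus 243.\<close>
      have "\<not> 81 dvd d"
      proof
        assume "81 dvd d"
        then have "81 dvd K1" "81 dvd K2" using K by (auto intro: dvd_trans)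
        then have "243 dvd x * K1" "243 dvd x * K2" by (auto simp: u)
        moreover have "1 + x = 1 + 3 * u" by (simp add: u)
        ultimately show False
          using not_243_dvd_power_expressions[OF 3 _ n] unfolding K1 K2
          by (simp only: u add_diff_cancel_left')
      qed
      \<comment> \<open>The 3-part of \<open>d\<close>, now at most 27, and the rest
        \<open>d'\<close> divide \<open>3 * w\<close> for separate reasons.\<close>
      obtain d' where d': "d = 3 ^ multiplicity 3 d * d'" "\<not> 3 dvd d'"
        using multiplicity_decompose'[of d "3::int"] d by auto
      have "\<not> 3 ^ 4 dvd d"
        using \<open>\<not> 81 dvd d\<close> by simp
      then have "multiplicity 3 d < 4"
        using multiplicity_dvd'[of 4 "3::int" d] by fastforce
      then have "(3::int) ^ multiplicity 3 d dvd 3 ^ 3"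
        by (intro le_imp_power_dvd) simp
      also have "3 ^ 3 dvd 3 * w"
        using nine_dvd_halved_square[OF True] by (auto simp: w_def)
      finally have 1: "3 ^ multiplicity 3 d dvd 3 * w" .
      have "d' dvd d" using d' by (metis dvd_triv_right)
      have "coprime d' (1 + u * t)"
      proof (rule coprime_if_no_common_prime)
        show "d' \<noteq> 0" using d' by auto
        fix p :: int assume p: "Factorial_Ring.prime p" "p dvd d'" "p dvd 1 + u * t"
        then have "p dvd x" using primes \<open>d' dvd d\<close> dvd_trans by blast
        then have "p dvd 3 \<or> p dvd u" using p(1) by (simp add: u prime_dvd_mult_iff)
        moreover have "p \<noteq> 3" using p d' by auto
        ultimately have "p dvd u" using p(1) primes_dvd_imp_eq[of p 3] by auto
        with p have "p dvd 1" by (simp add: dvd_add_left_iff)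
        with p(1) show False using not_prime_unit by blast
      qed
      moreover have "d' dvd w * (1 + u * t)"
        using \<open>d' dvd d\<close> dw by (rule dvd_trans)
      ultimately have 2: "d' dvd 3 * w"
        by (simp add: coprime_dvd_mult_left_iff)
      have "coprime (3 ^ multiplicity 3 d) d'"
        using d'(2) prime_imp_coprime[of 3 d'] by simp
      with 1 2 have "3 ^ multiplicity 3 d * d' dvd 3 * w"
        by (intro divides_mult)
      then show ?thesis
        using d'(1) True by (simp add: central_exponent_def w_def)
    qed
  qed
qed

section \<open>The relations of the Macdonald group\<close>

context group
begin

lemma inv_cancel_left [simp]:
  assumes "x \<in> carrier G" "y \<in> carrier G"
  shows "inv x \<otimes> (x \<otimes> y) = y" "x \<otimes> (inv x \<otimes> y) = y"
  using assms by (simp_all flip: m_assoc)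

text \<open>The equation \<open>x \<otimes> g = g \<otimes> y\<close> says that \<open>g\<close>
  conjugates \<open>x\<close> to \<open>y\<close>; without inverses it is directly usable for moving
  \<open>g\<close> through products.\<close>

lemma intertwine_inv:
  assumes "x \<otimes> g = g \<otimes> y" "x \<in> carrier G" "y \<in> carrier G" "g \<in> carrier G"
  shows "inv x \<otimes> g = g \<otimes> inv y" "y \<otimes> inv g = inv g \<otimes> x"
proof -
  have "inv x \<otimes> (x \<otimes> g) \<otimes> inv y = inv x \<otimes> (g \<otimes> y) \<otimes> inv y"
    by (simp only: assms(1))
  then show "inv x \<otimes> g = g \<otimes> inv y"
    using assms(2-) by (simp add: m_assoc)
  have "inv g \<otimes> (x \<otimes> g) \<otimes> inv g = inv g \<otimes> (g \<otimes> y) \<otimes> inv g"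
    by (simp only: assms(1))
  then show "y \<otimes> inv g = inv g \<otimes> x"
    using assms(2-) by (simp add: m_assoc)
qed

lemma intertwine_int_pow:
  assumes "x \<otimes> g = g \<otimes> y" "x \<in> carrier G" "y \<in> carrier G" "g \<in> carrier G"
  shows "x [^] (k::int) \<otimes> g = g \<otimes> y [^] k"
proof -
  have nat: "x [^] n \<otimes> g = g \<otimes> y [^] n" for n :: nat
  proof (induction n)
    case (Suc n)
    have "x [^] Suc n \<otimes> g = x [^] n \<otimes> g \<otimes> y"
      using assms by (simp add: m_assoc)
    with Suc show ?case
      using assms by (simp add: m_assoc)
  qed (use assms in simp)
  show ?thesis
  proof (cases k)
    case (nonneg n)
    then show ?thesis
      using nat by (simp add: int_pow_int)
  next
    case (neg n)
    have "x [^] Suc n \<otimes> g = g \<otimes> y [^] Suc n"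
      by (rule nat)
    then have "inv (x [^] Suc n) \<otimes> g = g \<otimes> inv (y [^] Suc n)"
      using assms(2-) by (intro intertwine_inv) simp_all
    then show ?thesis
      using assms neg by (simp only: int_pow_neg_int)
  qed
qed

lemma commute_int_pow:
  assumes "x \<otimes> y = y \<otimes> x" "x \<in> carrier G" "y \<in> carrier G"
  shows "x \<otimes> y [^] (k::int) = y [^] k \<otimes> x"
  using intertwine_int_pow[of y x y k] assms by simp

end

text \<open>The sum starts at \<open>\<alpha>\<close>, not at 1: it is the exponent of
  \<open>a\<close> that remains when all \<open>c\<close> in the \<open>k\<close>-th power of
  \<open>a \<otimes> c\<close> are collected on the left.\<close>

definition geom_sum :: "int \<Rightarrow> nat \<Rightarrow> int" where
  "geom_sum \<alpha> k = (\<Sum>i<k. \<alpha> ^ Suc i)"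

lemma geom_sum_0 [simp]: "geom_sum \<alpha> 0 = 0"
  by (simp add: geom_sum_def)

lemma geom_sum_Suc: "geom_sum \<alpha> (Suc k) = geom_sum \<alpha> k + \<alpha> ^ Suc k"
  by (simp add: geom_sum_def)

lemma geom_sum_Suc': "geom_sum \<alpha> (Suc k) = (geom_sum \<alpha> k + 1) * \<alpha>"
proof (induction k)
  case (Suc k)
  have "geom_sum \<alpha> (Suc (Suc k)) = geom_sum \<alpha> (Suc k) + \<alpha> ^ Suc (Suc k)"
    by (rule geom_sum_Suc)
  also have "\<dots> = (geom_sum \<alpha> k + 1) * \<alpha> + \<alpha> ^ Suc (Suc k)"
    by (simp only: Suc)
  also have "\<dots> = (geom_sum \<alpha> (Suc k) + 1) * \<alpha>"
    by (simp add: geom_sum_Suc algebra_simps)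
  finally show ?case .
qed (simp add: geom_sum_Suc)

lemma geom_sum_closed: "(\<alpha> - 1) * geom_sum \<alpha> k = \<alpha> ^ Suc k - \<alpha>"
  by (induction k) (simp_all add: geom_sum_Suc algebra_simps)

text \<open>The element \<open>c\<close> is the commutator of \<open>a\<close> and \<open>b\<close>; with it as a parameter, the assumptions
  are invariant under exchanging \<open>a\<close> and \<open>b\<close> and inverting \<open>c\<close>.\<close>

locale macdonald_triple = group G for G (structure) +
  fixes a b c :: 'a and \<alpha> :: int
  assumes a_closed [simp]: "a \<in> carrier G"
    and b_closed [simp]: "b \<in> carrier G"
    and c_closed [simp]: "c \<in> carrier G"
    and ab: "a \<otimes> b = b \<otimes> (a \<otimes> c)"
    and ac: "a \<otimes> c = c \<otimes> a [^] \<alpha>"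
    and cb: "c \<otimes> b = b [^] \<alpha> \<otimes> c"
begin

lemma swap: "macdonald_triple G b a (inv c) \<alpha>"
proof (unfold_locales)
  show "b \<otimes> a = a \<otimes> (b \<otimes> inv c)"
    using ab by (simp add: m_assoc flip: m_assoc[of a b])
  show "b \<otimes> inv c = inv c \<otimes> b [^] \<alpha>"
    using cb by (intro intertwine_inv) simp_all
  show "inv c \<otimes> a = a [^] \<alpha> \<otimes> inv c"
    using intertwine_inv(2)[OF ac] by simp
qed simp_all

lemma a_pow_c_pow: "a [^] (k::int) \<otimes> c [^] (j::nat) = c [^] j \<otimes> a [^] (k * \<alpha> ^ j)"
proof (induction j arbitrary: k)
  case (Suc j)
  have 1: "a [^] k \<otimes> c = c \<otimes> a [^] (\<alpha> * k)" for k :: int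
    using intertwine_int_pow[OF ac, of k] by (simp add: int_pow_pow)
  have "a [^] k \<otimes> c [^] Suc j = (a [^] k \<otimes> c [^] j) \<otimes> c"
    by (simp add: m_assoc)
  also have "\<dots> = c [^] j \<otimes> (a [^] (k * \<alpha> ^ j) \<otimes> c)"
    by (simp add: Suc m_assoc)
  finally show ?case
    by (simp add: 1 m_assoc mult_ac)
qed simp

lemma c_pow_b_pow: "c [^] (j::nat) \<otimes> b [^] (k::int) = b [^] (k * \<alpha> ^ j) \<otimes> c [^] j"
proof (induction j arbitrary: k)
  case (Suc j)
  have 1: "c \<otimes> b [^] k = b [^] (\<alpha> * k) \<otimes> c" for k :: int
    using intertwine_int_pow[OF cb[symmetric], of k] by (simp add: int_pow_pow)
  have "c [^] Suc j \<otimes> b [^] k = c [^] j \<otimes> b [^] (\<alpha> * k) \<otimes> c"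
    by (simp add: m_assoc 1)
  then show ?case
    by (simp add: Suc m_assoc mult_ac)
qed simp

text \<open>Moving one more \<open>c\<close> to the left past a power of \<open>a\<close> with
  exponent \<open>geom_sum \<alpha> k + 1\<close> multiplies that exponent by
  \<open>\<alpha>\<close>, which is the recursion \<open>geom_sum_Suc'\<close>.\<close>

lemma ac_pow: "(a \<otimes> c) [^] (k::nat) = c [^] k \<otimes> a [^] geom_sum \<alpha> k"
proof (induction k)
  case (Suc k)
  have "(a \<otimes> c) [^] Suc k = c [^] k \<otimes> (a [^] geom_sum \<alpha> k \<otimes> a [^] (1::int) \<otimes> c [^] (1::nat))"
    by (simp add: Suc m_assoc)
  also have "\<dots> = c [^] k \<otimes> (a [^] (geom_sum \<alpha> k + 1) \<otimes> c [^] (1::nat))"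
    by (simp only: int_pow_mult a_closed)
  also have "\<dots> = c [^] Suc k \<otimes> a [^] geom_sum \<alpha> (Suc k)"
    by (simp only: a_pow_c_pow) (simp add: geom_sum_Suc' m_assoc)
  finally show ?case .
qed simp

lemma a_pow_b: "a [^] (k::nat) \<otimes> b = b \<otimes> (c [^] k \<otimes> a [^] geom_sum \<alpha> k)"
  using intertwine_int_pow[OF ab, of "int k"] by (simp add: int_pow_int ac_pow)

lemma b_pow_a: "b [^] (k::nat) \<otimes> a = a \<otimes> (inv (c [^] k) \<otimes> b [^] geom_sum \<alpha> k)"
  using macdonald_triple.a_pow_b[OF swap, of k] by (simp add: nat_pow_inv)

text \<open>Conjugating \<open>a\<close> by \<open>b\<^sup>n\<close> and \<open>b\<^sup>n\<close> by \<open>a\<close> gives two expressions for the commutator of \<open>a\<close> and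
  \<open>b\<^sup>n\<close>.  They are comparable when \<open>n = \<alpha>\<^sup>j\<close>, because then \<open>b\<^sup>n\<close> is a conjugate of \<open>b\<close> by a
  power of \<open>c\<close>.\<close>

lemma b_pow_intertwine:
  assumes n: "int n = \<alpha> ^ j"
  defines "K \<equiv> \<alpha> ^ (n + j) - geom_sum \<alpha> n"
  shows "b [^] K \<otimes> c [^] (n + j) = c [^] (n + j) \<otimes> a [^] (- K)"
proof -
  define s where "s = geom_sum \<alpha> n"
  define r where "r = n + j"
  have cr: "c [^] r = c [^] n \<otimes> c [^] j" "c [^] r = c [^] j \<otimes> c [^] n"
    by (simp_all add: r_def nat_pow_mult add.commute)
  have acj: "a \<otimes> c [^] j = c [^] j \<otimes> a [^] n"
    using a_pow_c_pow[of 1 j] by (simp add: int_pow_int flip: n)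
  have cjb: "c [^] j \<otimes> b = b [^] n \<otimes> c [^] j"
    using c_pow_b_pow[of j 1] by (simp add: int_pow_int flip: n)
  have acr: "a \<otimes> c [^] r = c [^] r \<otimes> a [^] (\<alpha> ^ r)"
    using a_pow_c_pow[of 1 r] by simp
  have crb: "c [^] r \<otimes> b = b [^] (\<alpha> ^ r) \<otimes> c [^] r"
    using c_pow_b_pow[of r 1] by simp
  \<comment> \<open>First expression: \<open>b [^] n \<otimes> c [^] j\<close> is
    \<open>c [^] j \<otimes> b\<close>, so \<open>a\<close> moves past \<open>c [^] j\<close>,
    becoming \<open>a [^] n\<close>, and then past \<open>b\<close>.\<close>
  have "a \<otimes> (b [^] n \<otimes> c [^] j) = a \<otimes> c [^] j \<otimes> b"
    by (simp add: m_assoc flip: cjb)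
  also have "\<dots> = c [^] j \<otimes> (a [^] n \<otimes> b)"
    by (simp add: acj m_assoc)
  also have "\<dots> = (c [^] j \<otimes> b) \<otimes> (c [^] n \<otimes> a [^] s)"
    by (simp add: a_pow_b s_def m_assoc)
  also have "\<dots> = b [^] n \<otimes> (c [^] r \<otimes> a [^] s)"
    by (simp add: cjb m_assoc cr(2))
  finally have 1: "a \<otimes> (b [^] n \<otimes> c [^] j) = b [^] n \<otimes> (c [^] r \<otimes> a [^] s)" .
  \<comment> \<open>Second expression: \<open>b_pow_a\<close> writes \<open>a\<close> as a product
    beginning with \<open>b [^] n\<close>, which can then be cancelled against the first
    expression.\<close>
  have "(b [^] n \<otimes> a) \<otimes> (b [^] (-s) \<otimes> c [^] n) = a"
    by (simp add: b_pow_a s_def m_assoc int_pow_neg)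
  then have "a \<otimes> (b [^] n \<otimes> c [^] j) =
      (b [^] n \<otimes> a) \<otimes> (b [^] (-s) \<otimes> c [^] n) \<otimes> (b [^] n \<otimes> c [^] j)"
    by (simp only:)
  also have "\<dots> = b [^] n \<otimes> (a \<otimes> (b [^] (-s) \<otimes> (c [^] n \<otimes> (b [^] n \<otimes> c [^] j))))"
    by (simp add: m_assoc)
  finally have "a \<otimes> (b [^] n \<otimes> c [^] j) =
      b [^] n \<otimes> (a \<otimes> (b [^] (-s) \<otimes> (c [^] n \<otimes> (b [^] n \<otimes> c [^] j))))" .
  with 1 have "c [^] r \<otimes> a [^] s = a \<otimes> (b [^] (-s) \<otimes> (c [^] n \<otimes> (b [^] n \<otimes> c [^] j)))"
    by simp
  also have "c [^] n \<otimes> (b [^] n \<otimes> c [^] j) = c [^] r \<otimes> b"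
    by (simp add: cr(1) m_assoc flip: cjb)
  also have "a \<otimes> (b [^] (-s) \<otimes> (c [^] r \<otimes> b)) = a \<otimes> (b [^] (-s) \<otimes> b [^] (\<alpha> ^ r) \<otimes> c [^] r)"
    by (simp add: crb m_assoc)
  also have "\<dots> = a \<otimes> (b [^] K \<otimes> c [^] r)"
    by (simp add: K_def r_def s_def int_pow_mult[symmetric])
  finally have 2: "a \<otimes> (b [^] K \<otimes> c [^] r) = c [^] r \<otimes> a [^] s" by simp
  \<comment> \<open>The claimed right-hand side satisfies the same equation, because
    \<open>\<alpha> ^ r - K = s\<close>; cancelling \<open>a\<close> finishes.\<close>
  have "a \<otimes> (c [^] r \<otimes> a [^] (- K)) = c [^] r \<otimes> (a [^] (\<alpha> ^ r) \<otimes> a [^] (- K))"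
    using acr by (simp add: m_assoc[symmetric])
  also have "\<dots> = c [^] r \<otimes> a [^] s"
    by (simp add: K_def r_def s_def int_pow_mult[symmetric])
  finally have "a \<otimes> (b [^] K \<otimes> c [^] r) = a \<otimes> (c [^] r \<otimes> a [^] (- K))"
    using 2 by simp
  then show ?thesis
    by (simp flip: r_def)
qed

text \<open>Once \<open>a\<close> and \<open>b\<close> generate the group, these are the
  \<open>e\<close> with \<open>a [^] e\<close> central. They form an ideal of the integers, so
  divisibility arguments apply.\<close>

definition central_exponents :: "int set" where
  "central_exponents = {e. a [^] e \<otimes> b = b \<otimes> a [^] e}"

lemma central_exponents_add:
  assumes "e \<in> central_exponents" "f \<in> central_exponents"
  shows "e + f \<in> central_exponents"
proof -
  have "a [^] e \<otimes> (a [^] f \<otimes> b) = b \<otimes> (a [^] e \<otimes> a [^] f)"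
    using assms by (simp add: central_exponents_def m_assoc[symmetric])
  then show ?thesis
    by (simp add: central_exponents_def m_assoc int_pow_mult)
qed

lemma central_exponents_mult:
  assumes "e \<in> central_exponents"
  shows "k * e \<in> central_exponents"
  using assms intertwine_int_pow[of "a [^] e" b "a [^] e" k]
  by (simp add: central_exponents_def int_pow_pow mult.commute)

lemma central_exponents_gcd:
  assumes "e \<in> central_exponents" "f \<in> central_exponents"
  shows "gcd e f \<in> central_exponents"
proof -
  obtain u v where "u * e + v * f = gcd e f"
    using bezout_int[of e f] by blast
  with assms show ?thesis
    using central_exponents_add[OF central_exponents_mult central_exponents_mult, of e f u v] by simp
qed

lemma central_exponents_dvd:
  assumes "e \<in> central_exponents" "e dvd f"
  shows "f \<in> central_exponents"
  using assms by (auto elim!: dvdE simp: mult.commute[of e] intro: central_exponents_mult)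

text \<open>A power of \<open>a\<close> that commutes with \<open>a\<close> and \<open>b\<close>
  commutes with \<open>c\<close>, yet \<open>c\<close> conjugates it to its
  \<open>\<alpha>\<close>-th power.\<close>

lemma pow_central_exponent:
  assumes e: "e \<in> central_exponents"
  shows "a [^] (e * (\<alpha> - 1)) = \<one>"
proof -
  define z where "z = a [^] e"
  have z [simp]: "z \<in> carrier G" by (simp add: z_def)
  have zb: "z \<otimes> b = b \<otimes> z" using e by (simp add: z_def central_exponents_def)
  have za: "z \<otimes> a = a \<otimes> z" using commute_int_pow[of a a e] by (simp add: z_def)
  have za': "z \<otimes> (a \<otimes> y) = a \<otimes> (z \<otimes> y)" if "y \<in> carrier G" for y
    using that za by (simp flip: m_assoc)
  have zb': "z \<otimes> (b \<otimes> y) = b \<otimes> (z \<otimes> y)" if "y \<in> carrier G" for y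
    using that zb by (simp flip: m_assoc)
  have "b \<otimes> (a \<otimes> (z \<otimes> c)) = z \<otimes> (a \<otimes> b)"
    by (simp add: ab za' zb')
  also have "\<dots> = a \<otimes> b \<otimes> z"
    by (simp add: za' zb m_assoc)
  also have "\<dots> = b \<otimes> (a \<otimes> (c \<otimes> z))"
    by (simp add: ab m_assoc)
  finally have "z \<otimes> c = c \<otimes> z" by simp
  moreover have "z \<otimes> c = c \<otimes> a [^] (e * \<alpha>)"
    using a_pow_c_pow[of e 1] by (simp add: z_def)
  ultimately have "a [^] e = a [^] (e * \<alpha>)" by (simp add: z_def)
  then show ?thesis
    by (simp add: right_diff_distrib int_pow_diff)
qed

text \<open>Let \<open>d\<close> be the conjugate of \<open>b\<close> by \<open>c [^] r\<close>.
  Then \<open>a [^] (- K)\<close> is \<open>d [^] K\<close> by \<open>b_pow_intertwine\<close>, and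
  \<open>b\<close> is a power of \<open>d\<close> by the action of \<open>c\<close>. Powers of one
  element commute.\<close>

lemma central_exponents_K:
  assumes n: "int n = \<alpha> ^ j"
  shows "\<alpha> ^ (n + j) - geom_sum \<alpha> n \<in> central_exponents"
proof -
  define K where "K = \<alpha> ^ (n + j) - geom_sum \<alpha> n"
  define r where "r = n + j"
  define d where "d = inv (c [^] r) \<otimes> b \<otimes> c [^] r"
  have d [simp]: "d \<in> carrier G" by (simp add: d_def)
  have bd: "b \<otimes> c [^] r = c [^] r \<otimes> d" by (simp add: d_def m_assoc)
  have *: "b [^] K \<otimes> c [^] r = c [^] r \<otimes> a [^] (- K)"
    using b_pow_intertwine[OF n] by (simp add: K_def r_def)
  have "a [^] (- K) = d [^] K"
    using intertwine_int_pow[OF bd, of K] * by simp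
  moreover have "c [^] r \<otimes> b = c [^] r \<otimes> d [^] (\<alpha> ^ r)"
    using intertwine_int_pow[OF bd, of "\<alpha> ^ r"] c_pow_b_pow[of r 1] by simp
  then have "b = d [^] (\<alpha> ^ r)" by simp
  ultimately have "a [^] (- K) \<otimes> b = b \<otimes> a [^] (- K)"
    by (simp add: int_pow_mult[symmetric] add.commute)
  then have "- K \<in> central_exponents" by (simp add: central_exponents_def)
  from central_exponents_mult[OF this, of "-1"] show ?thesis by (simp add: K_def)
qed

end

section \<open>Divisibility of powers and geometric sums\<close>

lemma power_one_plus_expansion:
  fixes x :: int
  obtains P q where "(1 + x) ^ k = 1 + int k * x + P * x\<^sup>2 + q * x ^ 3" "2 * P = int k * (int k - 1)"
proof -
  have "\<exists>P q. (1 + x) ^ k = 1 + int k * x + P * x\<^sup>2 + q * x ^ 3 \<and> 2 * P = int k * (int k - 1)"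
  proof (induction k)
    case (Suc k)
    then obtain P q where IH: "(1 + x) ^ k = 1 + int k * x + P * x\<^sup>2 + q * x ^ 3"
        "2 * P = int k * (int k - 1)"
      by blast
    have "(1 + x) ^ Suc k =
        1 + int (Suc k) * x + (P + int k) * x\<^sup>2 + (P + q + x * q) * x ^ 3"
      by (simp add: IH(1) algebra_simps power2_eq_square power3_eq_cube)
    moreover have "2 * (P + int k) = int (Suc k) * (int (Suc k) - 1)"
      using IH(2) by (simp add: algebra_simps)
    ultimately show ?case by blast
  qed simp
  then show ?thesis using that by blast
qed

text \<open>This difference is the exponent of \<open>a\<close> in the commutator of
  \<open>a [^] k\<close> and \<open>b\<close>. It equals \<open>- x\<close> times the sum of
  \<open>i * (1 + x) ^ i\<close> over \<open>i < k\<close>, so \<open>P\<close> and \<open>Q\<close>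
  are the sums of \<open>i\<close> and of \<open>i\<^sup>2\<close>.\<close>

lemma geom_sum_defect_expansion:
  fixes x :: int
  obtains P Q q where
    "geom_sum (1 + x) k - int k * (1 + x) ^ k = - x * (P + x * Q + x\<^sup>2 * q)"
    "2 * P = int k * (int k - 1)" "6 * Q = int k * (int k - 1) * (2 * int k - 1)"
proof -
  have "\<exists>P Q q. geom_sum (1 + x) k - int k * (1 + x) ^ k = - x * (P + x * Q + x\<^sup>2 * q) \<and>
    2 * P = int k * (int k - 1) \<and> 6 * Q = int k * (int k - 1) * (2 * int k - 1)"
  proof (induction k)
    case (Suc k)
    then obtain P Q q where
        IH: "geom_sum (1 + x) k - int k * (1 + x) ^ k = - x * (P + x * Q + x\<^sup>2 * q)"
        "2 * P = int k * (int k - 1)" "6 * Q = int k * (int k - 1) * (2 * int k - 1)"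
      by blast
    obtain P' q' where e: "(1 + x) ^ k = 1 + int k * x + P' * x\<^sup>2 + q' * x ^ 3"
      by (rule power_one_plus_expansion)
    have "geom_sum (1 + x) (Suc k) - int (Suc k) * (1 + x) ^ Suc k =
        (geom_sum (1 + x) k - int k * (1 + x) ^ k) - x * int k * (1 + x) ^ k"
      by (simp add: geom_sum_Suc algebra_simps)
    also have "\<dots> = - x * ((P + int k) + x * (Q + int k * int k)
        + x\<^sup>2 * (q + int k * (P' + q' * x)))"
      unfolding IH(1) unfolding e by (simp add: algebra_simps power2_eq_square power3_eq_cube)
    finally have "geom_sum (1 + x) (Suc k) - int (Suc k) * (1 + x) ^ Suc k =
      - x * ((P + int k) + x * (Q + int k * int k) + x\<^sup>2 * (q + int k * (P' + q' * x)))" .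
    moreover have "2 * (P + int k) = int (Suc k) * (int (Suc k) - 1)"
      using IH(2) by (simp add: algebra_simps)
    moreover have "6 * (Q + int k * int k) = int (Suc k) * (int (Suc k) - 1) * (2 * int (Suc k) - 1)"
      using IH(3) by (simp add: algebra_simps)
    ultimately show ?case by blast
  qed (simp add: exI[of _ 0])
  then show ?thesis using that by blast
qed

lemma halved_square_dvd: "halved_square x dvd x\<^sup>2"
  by (subst square_eq_halved_square) simp

lemma even_halved_square: "even (halved_square x) \<longleftrightarrow> even x"
proof (cases "even x")
  case True
  then obtain y where "x = 2 * y" by blast
  then show ?thesis by (simp add: halved_square_def power_mult_distrib)
qed (simp add: halved_square_def)

text \<open>The denominator 2 of \<open>P\<close> is absorbed by \<open>u\<close> when
  \<open>x\<close> is even and by \<open>halved_square x - 1\<close> when \<open>x\<close> is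
  odd.\<close>

lemma halved_square_dvd_mult:
  assumes "2 * P = halved_square x * (halved_square x - 1)" "even x \<Longrightarrow> even u"
  shows "halved_square x dvd u * P"
proof (cases "even x")
  case True
  with assms(2) obtain v where "u = 2 * v" by blast
  then have "u * P = v * (halved_square x * (halved_square x - 1))"
    using assms(1) by (metis mult.assoc mult.commute)
  then show ?thesis by simp
next
  case False
  then have "even (halved_square x - 1)" by (simp add: even_halved_square)
  then obtain v where "halved_square x - 1 = 2 * v" by blast
  with assms(1) have "P = halved_square x * v" by simp
  then show ?thesis by simp
qed

text \<open>For \<open>k = x\<close> the linear term of the expansion is already
  \<open>x\<^sup>2\<close>.\<close>

lemma halved_square_dvd_pow_minus_1:
  assumes "int k = x"
  shows "halved_square x dvd (1 + x) ^ k - 1"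
proof -
  obtain P q where "(1 + x) ^ k = 1 + int k * x + P * x\<^sup>2 + q * x ^ 3"
    by (rule power_one_plus_expansion)
  then have "(1 + x) ^ k - 1 = x\<^sup>2 * (1 + P + q * x)"
    by (simp add: assms algebra_simps power2_eq_square power3_eq_cube)
  then show ?thesis
    using halved_square_dvd by auto
qed

lemma halved_square_dvd_defect:
  assumes "int k = x"
  shows "halved_square x dvd geom_sum (1 + x) k - int k * (1 + x) ^ k"
proof -
  obtain P Q q where e: "geom_sum (1 + x) k - int k * (1 + x) ^ k = - x * (P + x * Q + x\<^sup>2 * q)"
    and P: "2 * P = int k * (int k - 1)"
    by (rule geom_sum_defect_expansion)
  have "halved_square x dvd x * P"
  proof (cases "even x")
    case True
    then obtain y where y: "x = 2 * y" by blast
    with P assms have "P = y * (x - 1)" by simp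
    then show ?thesis by (simp add: y halved_square_def power2_eq_square)
  next
    case False
    then obtain y where "x = 2 * y + 1" by (rule oddE)
    with P assms have "P = x * y" by simp
    with False show ?thesis by (simp add: halved_square_def power2_eq_square)
  qed
  moreover have "- x * (P + x * Q + x\<^sup>2 * q) = - (x * P) - x\<^sup>2 * (Q + x * q)"
    by (simp add: algebra_simps power2_eq_square)
  ultimately show ?thesis
    using halved_square_dvd by (simp add: e)
qed

lemma central_exponent_dvd_cube: "central_exponent x dvd x ^ 3"
proof (cases "3 dvd x")
  case True
  then have "3 * halved_square x dvd x * x\<^sup>2"
    using halved_square_dvd by (rule mult_dvd_mono)
  then show ?thesis
    using True by (simp add: central_exponent_def power2_eq_square power3_eq_cube mult.assoc)
qed (simp add: central_exponent_def power3_eq_cube dvd_mult halved_square_dvd[unfolded power2_eq_square])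

lemma central_exponent_dvd_square_mult:
  assumes "3 dvd x \<Longrightarrow> 3 dvd P"
  shows "central_exponent x dvd x\<^sup>2 * P"
proof (cases "3 dvd x")
  case True
  then have "halved_square x * 3 dvd x\<^sup>2 * P"
    using halved_square_dvd assms by (intro mult_dvd_mono)
  then show ?thesis
    using True by (simp add: central_exponent_def mult.commute)
qed (simp add: central_exponent_def halved_square_dvd)

lemma central_exponent_dvd_mult_halved_square:
  "central_exponent x dvd x * halved_square x"
  by (auto simp: central_exponent_def mult_dvd_mono)

text \<open>Each term of the expansion is divisible. In the quadratic one the extra 3 comes from
  \<open>P\<close>, since 9 divides \<open>halved_square x\<close> when 3 divides
  \<open>x\<close>.\<close>

lemma central_exponent_dvd_pow_minus_1:
  assumes "int k = halved_square x"
  shows "central_exponent x dvd (1 + x) ^ k - 1"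
proof -
  obtain P q where e: "(1 + x) ^ k = 1 + int k * x + P * x\<^sup>2 + q * x ^ 3"
    and P: "2 * P = int k * (int k - 1)"
    by (rule power_one_plus_expansion)
  have "3 dvd P" if "3 dvd x"
  proof -
    from that have "9 dvd 2 * P"
      by (simp add: P assms nine_dvd_halved_square)
    then show ?thesis by presburger
  qed
  then have "central_exponent x dvd x * halved_square x + x\<^sup>2 * P + x ^ 3 * q"
    by (intro dvd_add central_exponent_dvd_square_mult central_exponent_dvd_mult_halved_square
        dvd_mult2[OF central_exponent_dvd_cube])
  then show ?thesis
    by (simp add: e assms algebra_simps)
qed

text \<open>If \<open>x = 3 * u\<close>, the 3 supplies the extra factor in \<open>x * P\<close>,
  and \<open>u\<close>, having the parity of \<open>x\<close>, absorbs the denominator of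
  \<open>P\<close>. In the next term \<open>Q\<close> supplies the 3.\<close>

lemma central_exponent_dvd_defect:
  assumes "int k = halved_square x"
  shows "central_exponent x dvd geom_sum (1 + x) k - int k * (1 + x) ^ k"
proof -
  obtain P Q q where e: "geom_sum (1 + x) k - int k * (1 + x) ^ k = - x * (P + x * Q + x\<^sup>2 * q)"
    and P: "2 * P = int k * (int k - 1)" and Q: "6 * Q = int k * (int k - 1) * (2 * int k - 1)"
    by (rule geom_sum_defect_expansion)
  have "central_exponent x dvd x * P"
  proof (cases "3 dvd x")
    case True
    then obtain u where u: "x = 3 * u" by blast
    then have "halved_square x dvd u * P"
      using P by (intro halved_square_dvd_mult) (simp_all add: assms)
    with True show ?thesis by (simp add: central_exponent_def u mult.assoc)
  next
    case False
    then show ?thesis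
      using P halved_square_dvd_mult[of P x x] by (simp add: assms central_exponent_def)
  qed
  moreover have "3 dvd Q" if "3 dvd x"
  proof -
    from that have "9 dvd 6 * Q"
      by (simp add: Q assms nine_dvd_halved_square)
    then show ?thesis by presburger
  qed
  ultimately have "central_exponent x dvd x * P + x\<^sup>2 * Q + x ^ 3 * q"
    by (intro dvd_add central_exponent_dvd_square_mult dvd_mult2[OF central_exponent_dvd_cube])
  also have "x * P + x\<^sup>2 * Q + x ^ 3 * q = - (- x * (P + x * Q + x\<^sup>2 * q))"
    by (simp add: algebra_simps power2_eq_square power3_eq_cube)
  finally show ?thesis
    by (simp only: e dvd_minus_iff)
qed

section \<open>Central powers of the generators\<close>

context macdonald_triple
begin

lemma ord_dvd_expression:
  assumes n: "int n = \<alpha> ^ j"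
  shows "int (ord a) dvd (\<alpha> - 1) * \<alpha> ^ (n + j) - (\<alpha> ^ (n + 1) - \<alpha>)"
proof -
  have "a [^] ((\<alpha> ^ (n + j) - geom_sum \<alpha> n) * (\<alpha> - 1)) = \<one>"
    by (intro pow_central_exponent central_exponents_K n)
  then have "int (ord a) dvd (\<alpha> ^ (n + j) - geom_sum \<alpha> n) * (\<alpha> - 1)"
    by (simp add: int_pow_eq_id)
  also have "\<dots> = (\<alpha> - 1) * \<alpha> ^ (n + j) - (\<alpha> - 1) * geom_sum \<alpha> n"
    by (simp add: algebra_simps)
  finally show ?thesis
    by (simp add: geom_sum_closed)
qed

text \<open>Since \<open>ord a\<close> is 0 for infinite order, a nonzero multiple of it suffices.
  The exponent for \<open>j = 2\<close> serves, as \<open>\<alpha>\<^sup>2\<close> is nonnegative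
  for either sign of \<open>\<alpha>\<close>; it can vanish only if \<open>\<alpha>\<close> divides
  1. For \<open>\<alpha> = - 1\<close> it does vanish, but there
  \<open>a\<^sup>2 = c\<^sup>2\<close>, which \<open>c\<close> both inverts and centralizes, so
  \<open>a\<^sup>4 = 1\<close>.\<close>

lemma ord_pos:
  assumes "\<alpha> \<notin> {0, 1}"
  shows "ord a > 0"
proof (cases "\<alpha> = - 1")
  case True
  have c2b: "c [^] (2::nat) \<otimes> b = b \<otimes> c [^] (2::nat)"
    using c_pow_b_pow[of 2 1] by (simp add: True)
  have "a [^] (2::nat) \<otimes> b = b \<otimes> c [^] (2::nat)"
    using a_pow_b[of 2] by (simp add: True geom_sum_def eval_nat_numeral)
  then have "a [^] (2::nat) \<otimes> b = c [^] (2::nat) \<otimes> b"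
    by (simp only: c2b)
  then have ac2: "a [^] (2::nat) = c [^] (2::nat)"
    by (metis a_closed b_closed c_closed nat_pow_closed right_cancel)
  have "a [^] (2::int) \<otimes> c [^] (1::nat) = c [^] (1::nat) \<otimes> a [^] (- 2 :: int)"
    using a_pow_c_pow[of 2 1] by (simp add: True)
  moreover have a2: "a [^] (2::int) = c [^] (2::nat)"
    using ac2 int_pow_int[of G a 2] by simp
  have "c [^] (2::nat) \<otimes> c = c \<otimes> c [^] (2::nat)"
    by (simp add: eval_nat_numeral m_assoc)
  ultimately have "c \<otimes> a [^] (2::int) = c \<otimes> a [^] (- 2 :: int)"
    by (simp add: a2)
  then have "a [^] (2::int) = a [^] (- 2 :: int)" by simp
  then have "int (ord a) dvd - 2 - 2"
    by (simp only: int_pow_eq[OF a_closed])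
  then show ?thesis by (auto intro: gr0I)
next
  case False
  define n where "n = nat (\<alpha>\<^sup>2)"
  have n: "int n = \<alpha> ^ 2" by (simp add: n_def)
  have "\<alpha> * (\<alpha> ^ n * (\<alpha> * \<alpha> - \<alpha> - 1) + 1) \<noteq> 0"
  proof
    assume "\<alpha> * (\<alpha> ^ n * (\<alpha> * \<alpha> - \<alpha> - 1) + 1) = 0"
    with assms have "\<alpha> ^ n * (\<alpha> * \<alpha> - \<alpha> - 1) + 1 = 0" by simp
    then have "1 = \<alpha> ^ n * - (\<alpha> * \<alpha> - \<alpha> - 1)" by (simp add: algebra_simps)
    moreover have "n > 0" using assms by (simp add: n_def)
    then have "\<alpha> dvd \<alpha> ^ n" by (simp add: dvd_power)
    ultimately have "\<alpha> dvd 1" by (metis dvd_mult2)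
    then have "\<alpha> = 1 \<or> \<alpha> = - 1" by auto
    with False assms show False by auto
  qed
  moreover have "(\<alpha> - 1) * \<alpha> ^ (n + 2) - (\<alpha> ^ (n + 1) - \<alpha>) = \<alpha> * (\<alpha> ^ n * (\<alpha> * \<alpha> - \<alpha> - 1) + 1)"
    by (simp add: algebra_simps power_add eval_nat_numeral)
  ultimately show ?thesis
    using ord_dvd_expression[OF n] by (auto intro: gr0I)
qed

text \<open>For \<open>M = ord a\<close>, conjugating \<open>a [^] M = \<one>\<close> by
  \<open>b\<close> shows that \<open>c [^] M\<close> is a power of \<open>a\<close>. It therefore
  commutes with \<open>a\<close>, although it conjugates \<open>a\<close> to its
  \<open>\<alpha> ^ M\<close>-th power.\<close>

lemma ord_dvd_pow_minus_1: "int (ord a) dvd \<alpha> ^ ord a - 1"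
proof -
  define M where "M = ord a"
  define s where "s = geom_sum \<alpha> M"
  have "b \<otimes> (c [^] M \<otimes> a [^] s) = b"
    using a_pow_b[of M] by (simp add: M_def s_def)
  then have "c [^] M \<otimes> a [^] s = \<one>"
    by simp
  then have "c [^] M \<otimes> a [^] s \<otimes> a [^] (- s) = a [^] (- s)"
    by simp
  then have cM: "c [^] M = a [^] (- s)"
    by (simp add: m_assoc int_pow_neg)
  have "a [^] (1::int) \<otimes> a [^] (- s) = a [^] (- s) \<otimes> a [^] (\<alpha> ^ M)"
    using a_pow_c_pow[of 1 M] by (simp add: cM)
  then have "a [^] (1 + - s) = a [^] (- s + \<alpha> ^ M)"
    by (simp only: int_pow_mult[OF a_closed, symmetric])
  then show ?thesis
    unfolding int_pow_eq[OF a_closed] by (simp add: M_def)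
qed

text \<open>The gcd of \<open>ord a\<close> and the exponents for \<open>j = 1\<close> and
  \<open>j = 2\<close> is a central exponent. Including \<open>ord a\<close> ensures that its prime
  divisors divide \<open>\<alpha> - 1\<close>, as \<open>dvd_central_exponent\<close>
  requires.\<close>

lemma central_exponent_central:
  assumes "\<alpha> \<ge> 3"
  shows "central_exponent (\<alpha> - 1) \<in> central_exponents"
proof -
  define M where "M = ord a"
  define n where "n = nat \<alpha>"
  have n: "int n = \<alpha>" using assms by (simp add: n_def)
  have pow: "int (n ^ j) = \<alpha> ^ j" for j by (simp add: n)
  define K1 where "K1 = \<alpha> ^ (n + 1) - geom_sum \<alpha> n"
  define K2 where "K2 = \<alpha> ^ (n\<^sup>2 + 2) - geom_sum \<alpha> (n\<^sup>2)"
  have K: "K1 \<in> central_exponents" "K2 \<in> central_exponents"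
    using central_exponents_K[OF pow, of 1] central_exponents_K[OF pow, of 2]
    by (simp_all add: K1_def K2_def)
  have "int M \<in> central_exponents"
    by (simp add: M_def central_exponents_def int_pow_int)
  define d where "d = gcd (int M) (gcd K1 K2)"
  have "d \<in> central_exponents"
    unfolding d_def by (intro central_exponents_gcd K) fact
  moreover have "d dvd central_exponent (\<alpha> - 1)"
  proof (rule dvd_central_exponent)
    have "M > 0" using ord_pos assms by (simp add: M_def)
    then show "d > 0" by (simp add: d_def)
    show "d dvd K1" "d dvd K2" unfolding d_def by (meson dvd_trans gcd_dvd1 gcd_dvd2)+
    show "int n = 1 + (\<alpha> - 1)" "\<alpha> - 1 > 0" using n assms by auto
    show "(\<alpha> - 1) * K1 = (\<alpha> - 1) * (1 + (\<alpha> - 1)) ^ (n + 1) -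
        ((1 + (\<alpha> - 1)) ^ (n + 1) - (1 + (\<alpha> - 1)))"
      using geom_sum_closed[of \<alpha> n] by (simp add: K1_def right_diff_distrib)
    show "(\<alpha> - 1) * K2 = (\<alpha> - 1) * (1 + (\<alpha> - 1)) ^ (n\<^sup>2 + 2) -
        ((1 + (\<alpha> - 1)) ^ (n\<^sup>2 + 1) - (1 + (\<alpha> - 1)))"
      using geom_sum_closed[of \<alpha> "n\<^sup>2"] by (simp add: K2_def right_diff_distrib)
    fix p :: int assume p: "Factorial_Ring.prime p" "p dvd d"
    define q where "q = nat p"
    have q: "int q = p" using p(1) by (simp add: q_def prime_ge_0_int)
    have "p dvd int M" using p(2) by (simp add: d_def)
    then have "q dvd M" by (simp flip: q)
    have "int q dvd int n - 1"
    proof (rule prime_dvd_pred)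
      show "int M dvd int n ^ M - 1"
        using ord_dvd_pow_minus_1 by (simp add: n M_def)
      show "int M dvd (int n - 1) * int n ^ (n ^ j + j) - (int n ^ (n ^ j + 1) - int n)" for j
        using ord_dvd_expression[OF pow, of j] by (simp only: n M_def)
      show "Factorial_Ring.prime q" using p(1) prime_int_nat_transfer[of p] by (simp only: q_def)
    qed fact+
    then show "p dvd \<alpha> - 1" by (simp add: q n)
  qed
  ultimately show ?thesis
    by (rule central_exponents_dvd)
qed

lemma change_exponent:
  assumes "int (ord a) dvd \<beta> - \<alpha>" "int (ord b) dvd \<beta> - \<alpha>"
  shows "macdonald_triple G a b c \<beta>"
proof unfold_locales
  have "a [^] \<alpha> = a [^] \<beta>" "b [^] \<alpha> = b [^] \<beta>"
    using assms by (simp_all add: int_pow_eq)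
  then show "a \<otimes> c = c \<otimes> a [^] \<beta>" "c \<otimes> b = b [^] \<beta> \<otimes> c"
    by (simp_all add: ac cb)
qed (simp_all add: ab)

end

section \<open>The upper central series\<close>

text \<open>The usual term Z_n(G), without an index shift. The commutator condition avoids taking
  preimages of centres of quotients.\<close>

primrec upper_central :: "('a, 'b) monoid_scheme \<Rightarrow> nat \<Rightarrow> 'a set" where
  "upper_central G 0 = {\<one>\<^bsub>G\<^esub>}"
| "upper_central G (Suc n) = {g \<in> carrier G. \<forall>h \<in> carrier G. commutator G g h \<in> upper_central G n}"

context group
begin

lemma commutator_closed [simp]:
  "x \<in> carrier G \<Longrightarrow> y \<in> carrier G \<Longrightarrow> commutator G x y \<in> carrier G"
  by (simp add: commutator_def)

lemma commutator_mult_left: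
  assumes "x \<in> carrier G" "y \<in> carrier G" "h \<in> carrier G"
  shows "commutator G (x \<otimes> y) h = inv y \<otimes> commutator G x h \<otimes> y \<otimes> commutator G y h"
  using assms by (simp add: commutator_def m_assoc inv_mult_group)

lemma commutator_mult_right:
  assumes "x \<in> carrier G" "y \<in> carrier G" "h \<in> carrier G"
  shows "commutator G h (x \<otimes> y) = commutator G h y \<otimes> (inv y \<otimes> commutator G h x \<otimes> y)"
  using assms by (simp add: commutator_def m_assoc inv_mult_group)

lemma commutator_inv_left:
  assumes "x \<in> carrier G" "h \<in> carrier G"
  shows "commutator G (inv x) h = x \<otimes> inv (commutator G x h) \<otimes> inv x"
  using assms by (simp add: commutator_def m_assoc inv_mult_group)

lemma commutator_inv_right:
  assumes "x \<in> carrier G" "h \<in> carrier G"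
  shows "commutator G h (inv x) = x \<otimes> inv (commutator G h x) \<otimes> inv x"
  using assms by (simp add: commutator_def m_assoc inv_mult_group)

lemma commutator_conj_left:
  assumes "x \<in> carrier G" "g \<in> carrier G" "h \<in> carrier G"
  shows "commutator G (x \<otimes> g \<otimes> inv x) h = x \<otimes> commutator G g (inv x \<otimes> h \<otimes> x) \<otimes> inv x"
  using assms by (simp add: commutator_def m_assoc inv_mult_group)

text \<open>The commutator identities produce conjugates of commutators, which stay in the previous
  term because it is normal.\<close>

lemma normal_upper_central: "upper_central G n \<lhd> G"
proof (induction n)
  case 0
  then show ?case
    by (simp add: normal_inv_iff triv_subgroup)
next
  case (Suc n)
  interpret N: normal "upper_central G n" G by (rule Suc)
  have "subgroup (upper_central G (Suc n)) G"
    by (rule subgroupI)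
       (auto simp: commutator_mult_left commutator_inv_left N.inv_op_closed1 N.inv_op_closed2
         intro!: exI[of _ "\<one>"], auto simp: commutator_def)
  then show ?case
    by (auto simp: normal_inv_iff commutator_conj_left N.inv_op_closed2)
qed

text \<open>Makes it enough to test membership in the upper central series on generators.\<close>

lemma commutators_subgroup:
  assumes "N \<lhd> G" "g \<in> carrier G"
  shows "subgroup {h \<in> carrier G. commutator G g h \<in> N} G"
proof -
  interpret N: normal N G by (rule assms)
  have "commutator G g \<one> = \<one>" using assms(2) by (simp add: commutator_def)
  then have "\<one> \<in> {h \<in> carrier G. commutator G g h \<in> N}" by simp
  then show ?thesis
    using assms(2)
    by (intro subgroupI)
       (auto simp: commutator_mult_right commutator_inv_right N.inv_op_closed1 N.inv_op_closed2)
qed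

lemma upper_central_SucI:
  assumes gen: "\<And>H. subgroup H G \<Longrightarrow> S \<subseteq> H \<Longrightarrow> carrier G \<subseteq> H"
    and "S \<subseteq> carrier G" "g \<in> carrier G" "\<And>s. s \<in> S \<Longrightarrow> commutator G g s \<in> upper_central G n"
  shows "g \<in> upper_central G (Suc n)"
  using gen[OF commutators_subgroup[OF normal_upper_central[of n] assms(3)]] assms(2-) by auto

lemma lower_central_subset_upper_central:
  assumes "carrier G \<subseteq> upper_central G m" "n \<le> m"
  shows "lower_central G n \<subseteq> upper_central G (m - n)"
  using assms(2)
proof (induction n)
  case (Suc n)
  interpret N: normal "upper_central G (m - Suc n)" G by (rule normal_upper_central)
  have "m - n = Suc (m - Suc n)" using Suc.prems by simp
  with Suc have "lower_central G n \<subseteq> upper_central G (Suc (m - Suc n))" by simp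
  then have "{commutator G x y | x y. x \<in> lower_central G n \<and> y \<in> carrier G}
      \<subseteq> upper_central G (m - Suc n)"
    by auto
  then show ?case
    by (simp add: generate_subgroup_incl N.subgroup_axioms)
qed (use assms(1) in simp)

lemma lower_central_trivial:
  assumes "carrier G \<subseteq> upper_central G n" "n > 0"
  shows "lower_central G n = {\<one>}"
proof
  show "lower_central G n \<subseteq> {\<one>}"
    using lower_central_subset_upper_central[OF assms(1), of n] by simp
  show "{\<one>} \<subseteq> lower_central G n"
    using assms(2) by (cases n) (auto intro: generate.one)
qed

end

section \<open>Powers of \<open>a\<close>, \<open>b\<close> and \<open>c\<close> in the upper
  central series\<close>

locale macdonald_generators = macdonald_triple +
  assumes generators: "\<And>H. subgroup H G \<Longrightarrow> a \<in> H \<Longrightarrow> b \<in> H \<Longrightarrow> carrier G \<subseteq> H"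
begin

lemma swap_generators: "macdonald_generators G b a (inv c) \<alpha>"
  using swap generators by (simp add: macdonald_generators_def macdonald_generators_axioms_def)

lemma upper_centralI:
  assumes "g \<in> carrier G" "commutator G g a \<in> upper_central G n" "commutator G g b \<in> upper_central G n"
  shows "g \<in> upper_central G (Suc n)"
  by (rule upper_central_SucI[of "{a, b}"]) (use assms generators in auto)

lemma commutator_c_pow_a: "commutator G (c [^] (k::nat)) a = a [^] (1 - \<alpha> ^ k)"
proof -
  have "inv a \<otimes> c [^] k = c [^] k \<otimes> a [^] (- (\<alpha> ^ k))"
    using a_pow_c_pow[of "- 1" k] by (simp add: int_pow_neg)
  then have "commutator G (c [^] k) a = a [^] (- (\<alpha> ^ k)) \<otimes> a [^] (1::int)"
    by (simp add: commutator_def m_assoc)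
  then show ?thesis
    by (simp only: int_pow_mult[OF a_closed, symmetric]) (simp add: add.commute)
qed

lemma commutator_a_pow_b:
  "commutator G (a [^] (k::nat)) b = c [^] k \<otimes> a [^] (geom_sum \<alpha> k - int k * \<alpha> ^ k)"
proof -
  have "commutator G (a [^] k) b = inv (a [^] k) \<otimes> inv b \<otimes> (a [^] k \<otimes> b)"
    by (simp add: commutator_def m_assoc)
  also have "\<dots> = a [^] (- int k) \<otimes> c [^] k \<otimes> a [^] geom_sum \<alpha> k"
    by (simp add: a_pow_b m_assoc int_pow_neg int_pow_int)
  also have "\<dots> = c [^] k \<otimes> (a [^] (- int k * \<alpha> ^ k) \<otimes> a [^] geom_sum \<alpha> k)"
    by (simp only: a_pow_c_pow) (simp add: m_assoc)
  finally show ?thesis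
    by (simp add: int_pow_mult[symmetric])
qed

lemma a_pow_upper_central:
  assumes "c [^] k \<in> upper_central G n" "a [^] (geom_sum \<alpha> k - int k * \<alpha> ^ k) \<in> upper_central G n"
  shows "a [^] (k::nat) \<in> upper_central G (Suc n)"
proof (rule upper_centralI)
  interpret N: normal "upper_central G n" G by (rule normal_upper_central)
  show "commutator G (a [^] k) b \<in> upper_central G n"
    using assms by (simp add: commutator_a_pow_b)
  have "a [^] k \<otimes> a = a \<otimes> a [^] k"
    using commute_int_pow[of a a "int k"] by (simp add: int_pow_int)
  then have "commutator G (a [^] k) a = \<one>"
    by (simp add: commutator_def m_assoc)
  then show "commutator G (a [^] k) a \<in> upper_central G n"
    by simp
qed simp

lemma b_pow_upper_central:
  assumes "c [^] k \<in> upper_central G n" "b [^] (geom_sum \<alpha> k - int k * \<alpha> ^ k) \<in> upper_central G n"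
  shows "b [^] (k::nat) \<in> upper_central G (Suc n)"
proof (rule macdonald_generators.a_pow_upper_central[OF swap_generators])
  interpret N: normal "upper_central G n" G by (rule normal_upper_central)
  show "inv c [^] k \<in> upper_central G n"
    using assms(1) by (simp add: nat_pow_inv)
qed fact

lemma c_pow_upper_central:
  assumes "a [^] (\<alpha> ^ k - 1) \<in> upper_central G n" "b [^] (\<alpha> ^ k - 1) \<in> upper_central G n"
  shows "c [^] (k::nat) \<in> upper_central G (Suc n)"
proof (rule upper_centralI)
  interpret N: normal "upper_central G n" G by (rule normal_upper_central)
  have neg: "x [^] (1 - \<alpha> ^ k) \<in> upper_central G n"
    if "x \<in> carrier G" "x [^] (\<alpha> ^ k - 1) \<in> upper_central G n" for x
    using that int_pow_neg[of x "\<alpha> ^ k - 1"] by simp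
  show "commutator G (c [^] k) a \<in> upper_central G n"
    using neg assms(1) by (simp add: commutator_c_pow_a)
  \<comment> \<open>Exchanging \<open>a\<close> and \<open>b\<close> inverts \<open>c\<close>, so
    the formula yields the commutator of the inverse, from which that of \<open>c [^] k\<close> is
    recovered by conjugation and inversion.\<close>
  have "commutator G (inv (c [^] k)) b \<in> upper_central G n"
    using macdonald_generators.commutator_c_pow_a[OF swap_generators, of k] neg[of b] assms(2)
    by (simp add: nat_pow_inv)
  then have "c [^] k \<otimes> inv (commutator G (c [^] k) b) \<otimes> inv (c [^] k) \<in> upper_central G n"
    by (simp add: commutator_inv_left)
  from N.inv_op_closed1[OF _ this, of "c [^] k"] have "inv (commutator G (c [^] k) b) \<in> upper_central G n"
    by (simp add: m_assoc)
  then show "commutator G (c [^] k) b \<in> upper_central G n"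
    using N.m_inv_closed by fastforce
qed simp

lemma pow_dvd_upper_central:
  assumes "x [^] k \<in> upper_central G n" "int k dvd e" "x \<in> carrier G"
  shows "x [^] (e::int) \<in> upper_central G n"
proof -
  from assms(2) obtain f where "e = int k * f" by blast
  then have "x [^] e = (x [^] k) [^] f"
    using assms(3) by (simp add: int_pow_pow int_pow_int[symmetric])
  then show ?thesis
    using assms(1) subgroup_int_pow_closed[OF normal_imp_subgroup[OF normal_upper_central]] by simp
qed

lemma central_exponent_upper_central:
  assumes "e \<in> central_exponents"
  shows "a [^] e \<in> upper_central G 1"
proof -
  have "a [^] e \<otimes> a = a \<otimes> a [^] e"
    using commute_int_pow[of a a e] by simp
  moreover have "a [^] e \<otimes> b = b \<otimes> a [^] e"
    using assms by (simp add: central_exponents_def)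
  ultimately have "commutator G (a [^] e) a = \<one>" "commutator G (a [^] e) b = \<one>"
    by (simp_all add: commutator_def m_assoc)
  then show ?thesis
    using upper_centralI[of "a [^] e" 0] by simp
qed

lemma lower_central_7:
  assumes \<alpha>: "\<alpha> \<ge> 3"
  shows "lower_central G 7 = {\<one>}"
proof -
  define x where "x = \<alpha> - 1"
  define k where "k = nat x"
  define w where "w = nat (halved_square x)"
  define d where "d = nat (central_exponent x)"
  have \<alpha>x: "\<alpha> = 1 + x" and k: "int k = x"
    using \<alpha> by (auto simp: x_def k_def)
  have "halved_square x \<ge> 0" by (simp add: halved_square_def)
  then have w: "int w = halved_square x" and d: "int d = central_exponent x"
    by (simp_all add: w_def d_def central_exponent_def)
  note arith =
    central_exponent_dvd_pow_minus_1[OF w, folded \<alpha>x d] central_exponent_dvd_defect[OF w, folded \<alpha>x d]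
    halved_square_dvd_pow_minus_1[OF k, folded \<alpha>x w] halved_square_dvd_defect[OF k, folded \<alpha>x w]
  \<comment> \<open>The series ascends; this aligns a power of \<open>c\<close> with a power of
    \<open>a\<close> or \<open>b\<close> known to lie one term lower.\<close>
  have up: "y \<in> upper_central G (Suc n)" if "y \<in> upper_central G n" for y n
  proof -
    interpret N: normal "upper_central G n" G by (rule normal_upper_central)
    have "commutator G y h \<in> upper_central G n" if "h \<in> carrier G" for h
      using that \<open>y \<in> upper_central G n\<close> N.m_closed[OF N.m_inv_closed N.inv_op_closed1[of h y], of y]
      by (simp add: commutator_def m_assoc)
    then show ?thesis using that by simp
  qed
  have "a [^] d \<in> upper_central G 1"
    using central_exponent_upper_central[OF central_exponent_central[OF \<alpha>]]
    by (simp flip: x_def d add: int_pow_int)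
  note Z1a = pow_dvd_upper_central[OF this _ a_closed]
  have "b [^] d \<in> upper_central G 1"
    using macdonald_generators.central_exponent_upper_central[OF swap_generators
        macdonald_triple.central_exponent_central[OF swap \<alpha>]]
    by (simp flip: x_def d add: int_pow_int)
  note Z1b = pow_dvd_upper_central[OF this _ b_closed]
  have Z2: "c [^] w \<in> upper_central G (Suc 1)"
    by (intro c_pow_upper_central Z1a Z1b arith)
  have "a [^] w \<in> upper_central G (Suc (Suc 1))"
    by (intro a_pow_upper_central Z2 up Z1a arith)
  note Z3a = pow_dvd_upper_central[OF this _ a_closed]
  have "b [^] w \<in> upper_central G (Suc (Suc 1))"
    by (intro b_pow_upper_central Z2 up Z1b arith)
  note Z3b = pow_dvd_upper_central[OF this _ b_closed]
  have Z4: "c [^] k \<in> upper_central G (Suc (Suc (Suc 1)))"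
    by (intro c_pow_upper_central Z3a Z3b arith)
  have "a [^] k \<in> upper_central G (Suc (Suc (Suc (Suc 1))))"
    by (intro a_pow_upper_central Z4 up Z3a arith)
  note Z5a = pow_dvd_upper_central[OF this _ a_closed]
  have "b [^] k \<in> upper_central G (Suc (Suc (Suc (Suc 1))))"
    by (intro b_pow_upper_central Z4 up Z3b arith)
  note Z5b = pow_dvd_upper_central[OF this _ b_closed]
  \<comment> \<open>For exponent 1 the power condition is that \<open>x\<close> divides
    \<open>\<alpha> - 1\<close>, and the exponent \<open>geom_sum \<alpha> 1 - \<alpha>\<close> in
    the last step is 0.\<close>
  have Z6: "c [^] (1::nat) \<in> upper_central G (Suc (Suc (Suc (Suc (Suc 1)))))"
    by (intro c_pow_upper_central Z5a Z5b) (simp_all add: k x_def)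
  have Z7a: "a [^] (1::nat) \<in> upper_central G (Suc (Suc (Suc (Suc (Suc (Suc 1))))))"
    by (intro a_pow_upper_central Z6 up Z5a) (simp add: geom_sum_def)
  have Z7b: "b [^] (1::nat) \<in> upper_central G (Suc (Suc (Suc (Suc (Suc (Suc 1))))))"
    by (intro b_pow_upper_central Z6 up Z5b) (simp add: geom_sum_def)
  have "carrier G \<subseteq> upper_central G 7"
  proof (rule generators)
    show "subgroup (upper_central G 7) G"
      by (rule normal_imp_subgroup[OF normal_upper_central])
    show "a \<in> upper_central G 7" "b \<in> upper_central G 7"
      using Z7a Z7b by (simp_all add: eval_nat_numeral del: upper_central.simps)
  qed
  then show ?thesis by (rule lower_central_trivial) simp
qed

end

section \<open>The presented group\<close>

lemma (in group) normal_closure_incl: "R \<subseteq> normal_closure G R"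
  by (auto simp: normal_closure_def)

text \<open>The tail of a reduced word is reduced, and multiplying it by the first letter causes no
  cancellation.\<close>

lemma free_group_induct [consumes 1, case_names Nil gen inv_gen]:
  assumes "w \<in> carrier (free_group S)"
    and "P []"
    and "\<And>x w. x \<in> S \<Longrightarrow> w \<in> carrier (free_group S) \<Longrightarrow> P w \<Longrightarrow> P (free_gen x \<otimes>\<^bsub>free_group S\<^esub> w)"
    and "\<And>x w. x \<in> S \<Longrightarrow> w \<in> carrier (free_group S) \<Longrightarrow> P w \<Longrightarrow>
      P (inv\<^bsub>free_group S\<^esub> free_gen x \<otimes>\<^bsub>free_group S\<^esub> w)"
  shows "P w"
  using assms(1)
proof (induction w)
  case (Cons l w)
  interpret F: group "free_group S" by (rule group_free_group)
  obtain x e where l: "l = (x, e)" by (cases l)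
  have w: "w \<in> carrier (free_group S)" and x: "x \<in> S"
    using Cons.prems by (auto simp: free_group_def reduced_Cons l)
  have "l # w = [l] \<otimes>\<^bsub>free_group S\<^esub> w"
    using Cons.prems by (auto simp: free_group_def push_letter_def reduced_Cons)
  moreover have "[(x, False)] = inv\<^bsub>free_group S\<^esub> free_gen x"
    using x by (intro F.inv_equality[symmetric])
      (auto simp: free_group_def free_gen_def push_letter_def inv_letter_def reduced_Cons)
  ultimately show ?case
    using assms(3)[OF x w Cons.IH[OF w]] assms(4)[OF x w Cons.IH[OF w]]
    by (cases e) (simp_all add: l free_gen_def)
qed (use assms(2) in simp)

lemma macdonald_group_generators:
  "\<exists>a b c. macdonald_generators (macdonald_group \<alpha>) a b c \<alpha>"
proof -
  define F where "F = free_group (UNIV :: macdonald_gen set)"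
  define A where "A = free_gen Gen_A"
  define B where "B = free_gen Gen_B"
  define C where "C = commutator F A B"
  define R where "R = {u \<otimes>\<^bsub>F\<^esub> inv\<^bsub>F\<^esub> v | u v. (u, v) \<in> macdonald_relations \<alpha>}"
  define N where "N = normal_closure F R"
  interpret F: group F unfolding F_def by (rule group_free_group)
  have A [simp]: "A \<in> carrier F" and B [simp]: "B \<in> carrier F"
    by (simp_all add: A_def B_def F_def free_gen_in_carrier)
  have C [simp]: "C \<in> carrier F" by (simp add: C_def)
  \<comment> \<open>Turns the second relation into one about \<open>C\<close>, so that both
    relations describe conjugation by the same element.\<close>
  have C_inv: "commutator F B A = inv\<^bsub>F\<^esub> C"
    by (simp add: C_def commutator_def F.m_assoc F.inv_mult_group)
  have rels: "macdonald_relations \<alpha> = {(inv\<^bsub>F\<^esub> C \<otimes>\<^bsub>F\<^esub> A \<otimes>\<^bsub>F\<^esub> C, A [^]\<^bsub>F\<^esub> \<alpha>),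
      (C \<otimes>\<^bsub>F\<^esub> B \<otimes>\<^bsub>F\<^esub> inv\<^bsub>F\<^esub> C, B [^]\<^bsub>F\<^esub> \<alpha>)}"
    using C_inv
    by (simp add: macdonald_relations_def Let_def conjugate_def flip: F_def A_def B_def C_def)
  have G: "macdonald_group \<alpha> = F Mod N"
    by (simp add: macdonald_group_def presented_group_def N_def R_def F_def)
  have "R \<subseteq> carrier F" by (auto simp: R_def rels)
  then interpret N: normal N F
    unfolding N_def by (rule F.normal_closure_normal)
  define \<pi> where "\<pi> = (\<lambda>w. N #>\<^bsub>F\<^esub> w)"
  define Q where "Q = F Mod N"
  interpret G: group Q unfolding Q_def by (rule N.factorgroup_is_group)
  interpret \<pi>: group_hom F Q \<pi>
    by unfold_locales (unfold \<pi>_def Q_def, rule N.r_coset_hom_Mod)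
  have rel: "\<pi> u = \<pi> v" if "(u, v) \<in> macdonald_relations \<alpha>" for u v
  proof -
    have uv: "u \<in> carrier F" "v \<in> carrier F" using that by (auto simp: rels)
    have "u \<otimes>\<^bsub>F\<^esub> inv\<^bsub>F\<^esub> v \<in> N"
      using that F.normal_closure_incl[of R] by (auto simp: N_def R_def)
    then have "u \<in> N #>\<^bsub>F\<^esub> v"
      using uv by (intro N.rcos_module_rev F.group_axioms)
    then show ?thesis
      unfolding \<pi>_def using uv F.repr_independence[OF _ _ N.subgroup_axioms] by blast
  qed
  have "macdonald_generators Q (\<pi> A) (\<pi> B) (\<pi> C) \<alpha>"
  proof unfold_locales
    have "A \<otimes>\<^bsub>F\<^esub> B = B \<otimes>\<^bsub>F\<^esub> (A \<otimes>\<^bsub>F\<^esub> C)"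
      by (simp add: C_def commutator_def F.m_assoc)
    from arg_cong[OF this, of \<pi>]
    show "\<pi> A \<otimes>\<^bsub>Q\<^esub> \<pi> B = \<pi> B \<otimes>\<^bsub>Q\<^esub> (\<pi> A \<otimes>\<^bsub>Q\<^esub> \<pi> C)"
      by simp
    have "\<pi> A [^]\<^bsub>Q\<^esub> \<alpha> = inv\<^bsub>Q\<^esub> \<pi> C \<otimes>\<^bsub>Q\<^esub> \<pi> A \<otimes>\<^bsub>Q\<^esub> \<pi> C"
      using rel[of "inv\<^bsub>F\<^esub> C \<otimes>\<^bsub>F\<^esub> A \<otimes>\<^bsub>F\<^esub> C" "A [^]\<^bsub>F\<^esub> \<alpha>"]
      by (simp add: rels \<pi>.hom_int_pow)
    then show "\<pi> A \<otimes>\<^bsub>Q\<^esub> \<pi> C = \<pi> C \<otimes>\<^bsub>Q\<^esub> \<pi> A [^]\<^bsub>Q\<^esub> \<alpha>"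
      by (simp add: G.m_assoc)
    have "\<pi> B [^]\<^bsub>Q\<^esub> \<alpha> = \<pi> C \<otimes>\<^bsub>Q\<^esub> \<pi> B \<otimes>\<^bsub>Q\<^esub> inv\<^bsub>Q\<^esub> \<pi> C"
      using rel[of "C \<otimes>\<^bsub>F\<^esub> B \<otimes>\<^bsub>F\<^esub> inv\<^bsub>F\<^esub> C" "B [^]\<^bsub>F\<^esub> \<alpha>"]
      by (simp add: rels \<pi>.hom_int_pow)
    then show "\<pi> C \<otimes>\<^bsub>Q\<^esub> \<pi> B = \<pi> B [^]\<^bsub>Q\<^esub> \<alpha> \<otimes>\<^bsub>Q\<^esub> \<pi> C"
      by (simp add: G.m_assoc)
  next
    fix H assume H: "subgroup H Q" "\<pi> A \<in> H" "\<pi> B \<in> H"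
    interpret H: subgroup H Q by (rule H)
    have gen: "\<pi> (free_gen x) \<in> H" for x
      using H by (cases x) (simp_all add: A_def B_def)
    have gen_closed: "free_gen x \<in> carrier F" for x :: macdonald_gen
      by (simp add: F_def free_gen_in_carrier)
    have "\<pi> w \<in> H" if "w \<in> carrier F" for w
      using that unfolding F_def
    proof (induction w rule: free_group_induct)
      case Nil
      have "[] = \<one>\<^bsub>F\<^esub>" by (simp add: F_def free_group_def)
      then show ?case by (metis \<pi>.hom_one H.one_closed)
    next
      case (gen x w)
      then show ?case
        using \<open>\<pi> (free_gen x) \<in> H\<close> gen_closed[of x] by (simp flip: F_def)
    next
      case (inv_gen x w)
      then show ?case
        using \<open>\<pi> (free_gen x) \<in> H\<close> gen_closed[of x] by (simp flip: F_def)
    qed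
    then show "carrier Q \<subseteq> H"
      by (auto simp: Q_def FactGroup_def RCOSETS_def \<pi>_def)
  qed simp_all
  then show ?thesis
    unfolding G Q_def by blast
qed

theorem theorem3p2:
  fixes \<alpha> :: int
  assumes "\<alpha> \<notin> {0, 1, 2}"
  shows "nilpotent_group (macdonald_group \<alpha>) \<and> nilpotency_class (macdonald_group \<alpha>) \<le> 7"
proof -
  define G where "G = macdonald_group \<alpha>"
  obtain a b c where gens: "macdonald_generators G a b c \<alpha>"
    using macdonald_group_generators[of \<alpha>] unfolding G_def by blast
  interpret macdonald_generators G a b c \<alpha> by (rule gens)
  define m where "m = int (ord a) * int (ord b)"
  have "ord a > 0" "ord b > 0"
    using ord_pos macdonald_triple.ord_pos[OF swap] assms by auto
  then have "m > 0" by (simp add: m_def)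
  \<comment> \<open>A number congruent to \<open>\<alpha>\<close> modulo both orders; as
    \<open>m\<close> is at least 1, the summand outweighs a negative \<open>\<alpha>\<close> by at
    least 3.\<close>
  define \<beta> where "\<beta> = \<alpha> + m * (\<bar>\<alpha>\<bar> + 3)"
  have "1 * (\<bar>\<alpha>\<bar> + 3) \<le> m * (\<bar>\<alpha>\<bar> + 3)"
    using \<open>m > 0\<close> by (intro mult_right_mono) auto
  then have "\<beta> \<ge> 3" by (simp add: \<beta>_def)
  have "macdonald_triple G a b c \<beta>"
    by (rule change_exponent) (simp_all add: \<beta>_def m_def)
  then have "macdonald_generators G a b c \<beta>"
    using generators by (simp add: macdonald_generators_def macdonald_generators_axioms_def)
  then have "lower_central G 7 = {\<one>\<^bsub>G\<^esub>}"
    using \<open>\<beta> \<ge> 3\<close> by (rule macdonald_generators.lower_central_7)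
  then show ?thesis
    unfolding nilpotent_group_def nilpotency_class_def G_def[symmetric]
    using is_group by (auto intro: Least_le)
qed

end
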